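(* Let $\sigma=\{\sigma_z\}_{z\in\mathbb{Z}}$ be i.i.d. strictly positive random variables with law $\mathbf{P}$, and suppose $L(x):=1/\mathbf{P}(\sigma_0>x)$ is slowly varying at infinity, i.e. $\lim_{u\to\infty}L(uv)/L(u)=1$ for every $v>0$. Let $\{X_s\}_{s\ge0}$ be the Bouchaud trap model in the landscape $\sigma$ started at $X_0=0$, with quenched law $P_\sigma$. Then, as $t\to\infty$, \[ P_\sigma(X_t\in\Gamma_t)\to 1 \quad\text{in } \mathbf{P}\text{-probability}.\]
   Context: The Bouchaud trap model (BTM) in the landscape $\sigma$ is the continuous-time Markov chain on $\mathbb{Z}$ with transition rates $w_{z\to y}=\frac{1}{2\sigma_z}$ if $|z-y|=1$ and $0$ otherwise; $P_\sigma$ denotes its law given $\sigma$ with $X_0=0$. Define $\ell_t:=\min\{s\ge0: sL(s)\ge t\}$, $r_t:=L(\ell_t)$, $Z^{(1)}_t:=\min\{z\in\mathbb{Z}^+:\sigma_z>\ell_t\}$, $Z^{(2)}_t:=\max\{z\in\mathbb{Z}^-:\sigma_z>\ell_t\}$ (with $\mathbb{Z}^+$ the positive and $\mathbb{Z}^-$ the non-positive integers), and $\Gamma_t:=\{Z^{(1)}_t,Z^{(2)}_t\}$. *)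

theory Defs
  imports "HOL-Probability.Probability"
begin

definition tailL :: "real measure \<Rightarrow> real \<Rightarrow> real" where
  "tailL \<mu> x = 1 / measure \<mu> {x<..}"

definition slowly_varying :: "(real \<Rightarrow> real) \<Rightarrow> bool" where
  "slowly_varying L \<longleftrightarrow> (\<forall>v>0. ((\<lambda>u. L (u * v) / L u) \<longlongrightarrow> 1) at_top)"

definition ell :: "real measure \<Rightarrow> real \<Rightarrow> real" where
  "ell \<mu> t = Inf {s. 0 \<le> s \<and> t \<le> s * tailL \<mu> s}"

definition Z1 :: "real measure \<Rightarrow> (int \<Rightarrow> real) \<Rightarrow> real \<Rightarrow> int" where
  "Z1 \<mu> \<sigma> t = (LEAST z::int. 0 < z \<and> ell \<mu> t < \<sigma> z)"

definition Z2 :: "real measure \<Rightarrow> (int \<Rightarrow> real) \<Rightarrow> real \<Rightarrow> int" where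
  "Z2 \<mu> \<sigma> t = (GREATEST z::int. z \<le> 0 \<and> ell \<mu> t < \<sigma> z)"

definition Gamma :: "real measure \<Rightarrow> (int \<Rightarrow> real) \<Rightarrow> real \<Rightarrow> int set" where
  "Gamma \<mu> \<sigma> t = {Z1 \<mu> \<sigma> t, Z2 \<mu> \<sigma> t}"

definition env :: "real measure \<Rightarrow> (int \<Rightarrow> real) measure" where
  "env \<mu> = PiM UNIV (\<lambda>_::int. \<mu>)"

definition step_law :: "(int \<times> real) measure" where
  "step_law = measure_pmf (pmf_of_set {-1, 1::int}) \<Otimes>\<^sub>M density lborel (exponential_density 1)"

definition path_space :: "(nat \<Rightarrow> int \<times> real) measure" where
  "path_space = PiM UNIV (\<lambda>_::nat. step_law)"

definition walk :: "(nat \<Rightarrow> int \<times> real) \<Rightarrow> nat \<Rightarrow> int" where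
  "walk \<omega> n = (\<Sum>k<n. fst (\<omega> k))"

text \<open>Jump times: holding time at z is sigma_z times an Exp(1) variable
  (total jump rate 1/sigma_z, each neighbour with probability 1/2).\<close>
definition jumptime :: "(int \<Rightarrow> real) \<Rightarrow> (nat \<Rightarrow> int \<times> real) \<Rightarrow> nat \<Rightarrow> real" where
  "jumptime \<sigma> \<omega> n = (\<Sum>k<n. \<sigma> (walk \<omega> k) * snd (\<omega> k))"

definition btm :: "(int \<Rightarrow> real) \<Rightarrow> (nat \<Rightarrow> int \<times> real) \<Rightarrow> real \<Rightarrow> int" where
  "btm \<sigma> \<omega> t = walk \<omega> (LEAST n. t < jumptime \<sigma> \<omega> (Suc n))"

definition btm_prob :: "(int \<Rightarrow> real) \<Rightarrow> real \<Rightarrow> int set \<Rightarrow> real" where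
  "btm_prob \<sigma> t A = measure path_space {\<omega> \<in> space path_space. btm \<sigma> \<omega> t \<in> A}"

end

theory Submission
  imports Defs
begin

text \<open>
  For a fixed landscape, decompose at the last visit to \<open>\<Gamma>\<close>: an excursion away from \<open>\<Gamma>\<close> leaves
  a site \<open>z \<in> \<Gamma>\<close> at rate \<open>P(X\<^sub>u = z) / \<sigma>\<^sub>z \<le> 1 / \<sigma>\<^sub>z\<close> at time \<open>u\<close>, so that
  \<open>P(X\<^sub>t \<notin> \<Gamma>)\<close> is at most \<open>P(T > t) + (\<Sum>z\<in>\<Gamma>. E\<^sub>z[E \<and> t] / \<sigma>\<^sub>z)\<close>, where \<open>T\<close> is the hitting time of
  \<open>\<Gamma>\<close> and \<open>E\<close> the duration of one excursion.  Both terms are controlled by the Green function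
  \<open>2 min(i, j)\<close> of simple random walk on the half line: with \<open>r = L(\<ell>)\<close> and \<open>t \<approx> r \<ell>\<close>, the first is
  of order \<open>r S / t\<close>, and the second of order \<open>(t / b + S) / \<sigma>\<^sub>z\<close>, where \<open>S\<close> is the sum of the
  shallow traps (depth at most \<open>\<ell>\<close>) in a window of order \<open>r\<close> and \<open>b\<close> is a small multiple of \<open>r\<close>
  such that no two deep traps are within distance \<open>b\<close>.
  Slow variation makes \<open>S\<close> of order \<open>o(\<ell>)\<close>, because the truncated mean \<open>E[\<sigma>; \<sigma> \<le> u]\<close> is
  \<open>o(u P(\<sigma> > u))\<close>, and makes every trap deeper than \<open>\<ell>\<close> deeper than \<open>C \<ell>\<close> with high probability.

  The decomposition is not carried out on paths: the exit probability satisfies a one-step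
  recursion, and the right-hand side above is a supersolution of it.
\<close>

section \<open>One step of the chain\<close>

abbreviation exp1 :: "real measure" where
  "exp1 \<equiv> density lborel (exponential_density 1)"

lemma prob_space_exp1: "prob_space exp1"
  by (rule prob_space_exponential_density) simp

lemma AE_exp1_nonneg: "AE e in exp1. 0 \<le> e"
  by (subst AE_density) (auto simp: exponential_density_def)

lemma prob_space_step_law: "prob_space step_law"
  unfolding step_law_def
  by (intro prob_space_pair prob_space_exp1 measure_pmf.prob_space_axioms)

lemma sets_step_law [measurable_cong]: "sets step_law = sets (count_space UNIV \<Otimes>\<^sub>M borel)"
  unfolding step_law_def by (intro sets_pair_measure_cong) auto

lemma nn_integral_step_law:
  assumes [measurable]: "f \<in> borel_measurable (count_space UNIV \<Otimes>\<^sub>M borel)"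
  shows "(\<integral>\<^sup>+y. f y \<partial>step_law) = ((\<integral>\<^sup>+e. f (1, e) \<partial>exp1) + (\<integral>\<^sup>+e. f (-1, e) \<partial>exp1)) / 2"
proof -
  interpret E: prob_space exp1 by (rule prob_space_exp1)
  have "(\<integral>\<^sup>+y. f y \<partial>step_law) = (\<integral>\<^sup>+s. \<integral>\<^sup>+e. f (s, e) \<partial>exp1 \<partial>measure_pmf (pmf_of_set {-1, 1::int}))"
    unfolding step_law_def by (subst E.nn_integral_fst[symmetric]) auto
  also have "\<dots> = ((\<integral>\<^sup>+e. f (1, e) \<partial>exp1) + (\<integral>\<^sup>+e. f (-1, e) \<partial>exp1)) / 2"
    by (subst nn_integral_pmf_of_set) (auto simp: add.commute)
  finally show ?thesis .
qed

text \<open>With \<open>e\<close> standard exponential, \<open>c * e\<close> is the holding time: \<open>push c g f t\<close> has value \<open>g\<close> if the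
  chain has not jumped by time \<open>t\<close>, and otherwise \<open>f\<close> of the time that remains.\<close>

definition push :: "real \<Rightarrow> ennreal \<Rightarrow> (real \<Rightarrow> ennreal) \<Rightarrow> real \<Rightarrow> ennreal" where
  "push c g f t = (\<integral>\<^sup>+e. (if t < c * e then g else f (t - c * e)) \<partial>exp1)"

lemma measurable_push [measurable]:
  assumes [measurable]: "f \<in> borel_measurable borel"
  shows "push c g f \<in> borel_measurable borel"
proof -
  interpret E: prob_space exp1 by (rule prob_space_exp1)
  show ?thesis unfolding push_def by measurable
qed

lemma push_mono:
  assumes "0 < c" "g \<le> g'" "\<And>s. 0 \<le> s \<Longrightarrow> s \<le> t \<Longrightarrow> f s \<le> f' s"
  shows "push c g f t \<le> push c g' f' t"
  unfolding push_def
proof (rule nn_integral_mono_AE, use AE_exp1_nonneg in eventually_elim)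
  fix e :: real assume "0 \<le> e"
  with assms(1) have "0 \<le> c * e" by simp
  then show "(if t < c * e then g else f (t - c * e)) \<le> (if t < c * e then g' else f' (t - c * e))"
    using assms by auto
qed

lemma push_const: "push c k (\<lambda>_. k) t = k"
  using prob_space.emeasure_space_1[OF prob_space_exp1] by (simp add: push_def)

lemma push_add:
  assumes [measurable]: "f \<in> borel_measurable borel" "f' \<in> borel_measurable borel"
  shows "push c (g + g') (\<lambda>s. f s + f' s) t = push c g f t + push c g' f' t"
  unfolding push_def
  by (subst nn_integral_add[symmetric]) (auto intro!: nn_integral_cong)

lemma push_antimono:
  assumes "0 < c" "\<And>s s'. 0 \<le> s \<Longrightarrow> s \<le> s' \<Longrightarrow> f s' \<le> f s" "\<And>s. f s \<le> g" "t \<le> t'"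
  shows "push c g f t' \<le> push c g f t"
  unfolding push_def using assms
  by (intro nn_integral_mono) (auto intro: order_trans)

text \<open>Substituting \<open>v = t - c * e\<close>, the time left after the jump, shows
  \<open>push c 0 f\<close> to be the convolution of \<open>f\<close> on \<open>[0, t]\<close> with
  the exponential density of mean \<open>c\<close>.\<close>

lemma push_0_eq:
  assumes [measurable]: "f \<in> borel_measurable borel" and c: "0 < c"
  shows "push c 0 f t = (\<integral>\<^sup>+v. f v * indicator {0..t} v * ennreal (exp (- ((t - v) / c)) / c) \<partial>lborel)"
proof -
  have "push c 0 f t = (\<integral>\<^sup>+e. ennreal (exponential_density 1 e) * (if t < c * e then 0 else f (t - c * e)) \<partial>lborel)"
    unfolding push_def by (subst nn_integral_density) auto
  also have "\<dots> = ennreal \<bar>- (1 / c)\<bar> * (\<integral>\<^sup>+v. ennreal (exponential_density 1 (t / c + - (1 / c) * v)) *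
      (if t < c * (t / c + - (1 / c) * v) then 0 else f (t - c * (t / c + - (1 / c) * v))) \<partial>lborel)"
    using c by (subst nn_integral_real_affine[where t="t / c" and c="- (1 / c)"]) auto
  also have "\<dots> = (\<integral>\<^sup>+v. ennreal \<bar>- (1 / c)\<bar> * (ennreal (exponential_density 1 (t / c + - (1 / c) * v)) *
      (if t < c * (t / c + - (1 / c) * v) then 0 else f (t - c * (t / c + - (1 / c) * v)))) \<partial>lborel)"
    by (subst nn_integral_cmult) auto
  also have "\<dots> = (\<integral>\<^sup>+v. f v * indicator {0..t} v * ennreal (exp (- ((t - v) / c)) / c) \<partial>lborel)"
  proof (intro nn_integral_cong)
    fix v :: real
    have e: "c * (t / c + - (1 / c) * v) = t - v" "t / c + - (1 / c) * v = (t - v) / c"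
      using c by (auto simp: field_simps)
    show "ennreal \<bar>- (1 / c)\<bar> * (ennreal (exponential_density 1 (t / c + - (1 / c) * v)) *
      (if t < c * (t / c + - (1 / c) * v) then 0 else f (t - c * (t / c + - (1 / c) * v))))
      = f v * indicator {0..t} v * ennreal (exp (- ((t - v) / c)) / c)"
      unfolding e using c
      by (auto simp: exponential_density_def indicator_def divide_less_0_iff ennreal_mult'' mult_ac
          simp flip: ennreal_mult')
  qed
  finally show ?thesis .
qed

text \<open>Holding time at a site of \<open>\<Gamma>\<close>: integration by parts shows that \<open>K\<close> absorbs the next excursion \<open>h\<close>.\<close>

lemma push_0_renewal:
  assumes [measurable]: "h \<in> borel_measurable borel" "k \<in> borel_measurable borel" and c: "0 < c"
    and hk: "\<And>s. h s / ennreal c \<le> k s"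
  defines "K \<equiv> \<lambda>t. \<integral>\<^sup>+s. k s * indicator {0..t} s \<partial>lborel"
  shows "push c 0 h t + push c 0 K t \<le> K t"
proof -
  let ?q = "\<lambda>v. exp (- ((t - v) / c))"
  have [measurable]: "K \<in> borel_measurable borel"
    unfolding K_def atLeastAtMost_iff indicator_def by measurable
  have "push c 0 K t = (\<integral>\<^sup>+v. (\<integral>\<^sup>+s. k s * indicator {0..v} s * indicator {0..t} v * ennreal (?q v / c) \<partial>lborel) \<partial>lborel)"
    unfolding push_0_eq[OF \<open>K \<in> _\<close> c]
    by (intro nn_integral_cong, unfold K_def, (subst nn_integral_multc[symmetric], simp)+) (rule refl)
  also have "\<dots> = (\<integral>\<^sup>+s. (\<integral>\<^sup>+v. k s * indicator {0..v} s * indicator {0..t} v * ennreal (?q v / c) \<partial>lborel) \<partial>lborel)"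
    unfolding atLeastAtMost_iff indicator_def by (subst lborel_pair.Fubini') (auto)
  also have "\<dots> = (\<integral>\<^sup>+s. k s * indicator {0..t} s * (\<integral>\<^sup>+v. ennreal (?q v / c) * indicator {s..t} v \<partial>lborel) \<partial>lborel)"
    by (subst nn_integral_cmult[symmetric]) (auto intro!: nn_integral_cong simp: indicator_def)
  also have "\<dots> = (\<integral>\<^sup>+s. k s * indicator {0..t} s * ennreal (1 - ?q s) \<partial>lborel)"
  proof (intro nn_integral_cong)
    fix s :: real
    show "k s * indicator {0..t} s * (\<integral>\<^sup>+v. ennreal (?q v / c) * indicator {s..t} v \<partial>lborel)
        = k s * indicator {0..t} s * ennreal (1 - ?q s)"
    proof (cases "0 \<le> s \<and> s \<le> t")
      case True
      have "(\<integral>\<^sup>+v. ennreal (?q v / c) * indicator {s..t} v \<partial>lborel) = ennreal (?q t - ?q s)"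
        using True c by (intro nn_integral_FTC_Icc) (auto intro!: derivative_eq_intros)
      then show ?thesis by simp
    qed auto
  qed
  finally have 1: "push c 0 K t = (\<integral>\<^sup>+s. k s * indicator {0..t} s * ennreal (1 - ?q s) \<partial>lborel)" .
  have "push c 0 h t = (\<integral>\<^sup>+s. h s * indicator {0..t} s * ennreal (?q s / c) \<partial>lborel)"
    by (rule push_0_eq) (use c in auto)
  \<comment> \<open>The factor \<open>1 / c\<close> of the density is moved onto \<open>h\<close>,
    where \<open>hk\<close> applies. The remaining weight \<open>?q s\<close> and the weight
    \<open>1 - ?q s\<close> found above then add up to 1.\<close>
  also have "\<dots> \<le> (\<integral>\<^sup>+s. k s * indicator {0..t} s * ennreal (?q s) \<partial>lborel)"
  proof (intro nn_integral_mono)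
    fix s
    have "h s * indicator {0..t} s * ennreal (?q s / c) = (h s / ennreal c) * indicator {0..t} s * ennreal (?q s)"
      using c by (simp add: divide_ennreal[symmetric] ennreal_divide_times mult_ac ennreal_times_divide)
    also have "\<dots> \<le> k s * indicator {0..t} s * ennreal (?q s)"
      by (intro mult_right_mono hk) auto
    finally show "h s * indicator {0..t} s * ennreal (?q s / c) \<le> \<dots>" .
  qed
  finally have "push c 0 h t + push c 0 K t \<le>
      (\<integral>\<^sup>+s. k s * indicator {0..t} s * ennreal (?q s) + k s * indicator {0..t} s * ennreal (1 - ?q s) \<partial>lborel)"
    unfolding 1 by (subst nn_integral_add) (auto intro: add_right_mono)
  also have "\<dots> = K t"
    unfolding K_def
  proof (intro nn_integral_cong)
    fix s
    have "ennreal (?q s) + ennreal (1 - ?q s) = 1" if "s \<le> t"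
      using that c by (subst ennreal_plus[symmetric]) auto
    then show "k s * indicator {0..t} s * ennreal (?q s) + k s * indicator {0..t} s * ennreal (1 - ?q s) = k s * indicator {0..t} s"
      by (auto simp: indicator_def simp flip: distrib_left)
  qed
  finally show ?thesis .
qed

text \<open>Dropping the condition that the jump comes before \<open>t\<close> leaves the Laplace
  transform at 1 of an exponential variable of mean \<open>c\<close>, which is
  \<open>1 / (1 + c)\<close>.\<close>

lemma push_exp_le:
  assumes c: "0 < c" and a: "0 \<le> a"
  shows "push c 0 (\<lambda>s. ennreal (exp s * a)) t \<le> ennreal (exp t * (a / (1 + c)))"
proof -
  interpret E: prob_space "density lborel (exponential_density (1 + c))"
    by (rule prob_space_exponential_density) (use c in simp)
  have "push c 0 (\<lambda>s. ennreal (exp s * a)) t \<le> (\<integral>\<^sup>+e. ennreal (exp (t - c * e) * a) \<partial>exp1)"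
    unfolding push_def by (intro nn_integral_mono) auto
  also have "\<dots> = (\<integral>\<^sup>+e. ennreal (exponential_density 1 e) * ennreal (exp (t - c * e) * a) \<partial>lborel)"
    by (subst nn_integral_density) auto
  \<comment> \<open>Exponential tilting: \<open>exp (- c * e)\<close> times the density of rate 1 is
    \<open>1 / (1 + c)\<close> times the density of rate \<open>1 + c\<close>.\<close>
  also have "\<dots> = (\<integral>\<^sup>+e. ennreal (exp t * (a / (1 + c))) * ennreal (exponential_density (1 + c) e) \<partial>lborel)"
    using a c
    by (intro nn_integral_cong)
       (auto simp: exponential_density_def divide_simps algebra_simps simp flip: ennreal_mult' exp_add)
  also have "\<dots> = ennreal (exp t * (a / (1 + c))) * (\<integral>\<^sup>+e. ennreal (exponential_density (1 + c) e) \<partial>lborel)"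
    by (subst nn_integral_cmult) auto
  also have "(\<integral>\<^sup>+e. ennreal (exponential_density (1 + c) e) \<partial>lborel) = 1"
    using E.emeasure_space_1 by (simp add: emeasure_density)
  finally show ?thesis by simp
qed

lemma nn_integral_exp1: "(\<integral>\<^sup>+e. ennreal e \<partial>exp1) = 1"
proof -
  have "(\<integral>\<^sup>+e. ennreal e \<partial>exp1) = (\<integral>\<^sup>+e. ennreal (exponential_density 1 e * e ^ 1) \<partial>lborel)"
    by (subst nn_integral_density) (auto intro!: nn_integral_cong simp: exponential_density_def simp flip: ennreal_mult')
  also have "\<dots> = 1"
    using nn_integral_erlang_ith_moment[of 1 0 1] by simp
  finally show ?thesis .
qed

text \<open>The time integral splits at the first jump: the holding time costs its mean
  \<open>c\<close>, and what follows is a translate of \<open>f\<close>, seen through a window no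
  longer than \<open>[0, T]\<close>.\<close>

lemma nn_integral_push_le:
  assumes [measurable]: "f \<in> borel_measurable borel" and c: "0 < c"
  shows "(\<integral>\<^sup>+s. push c 1 f s * indicator {0..T} s \<partial>lborel) \<le> ennreal c + (\<integral>\<^sup>+s. f s * indicator {0..T} s \<partial>lborel)"
proof -
  interpret E: prob_space exp1 by (rule prob_space_exp1)
  interpret P: pair_sigma_finite lborel exp1 ..
  let ?F = "\<integral>\<^sup>+s. f s * indicator {0..T} s \<partial>lborel"
  have "(\<integral>\<^sup>+s. push c 1 f s * indicator {0..T} s \<partial>lborel)
      = (\<integral>\<^sup>+s. (\<integral>\<^sup>+e. (if s < c * e then 1 else f (s - c * e)) * indicator {0..T} s \<partial>exp1) \<partial>lborel)"
    unfolding push_def by (subst nn_integral_multc) auto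
  also have "\<dots> = (\<integral>\<^sup>+e. (\<integral>\<^sup>+s. (if s < c * e then 1 else f (s - c * e)) * indicator {0..T} s \<partial>lborel) \<partial>exp1)"
    unfolding atLeastAtMost_iff indicator_def by (subst P.Fubini') auto
  also have "\<dots> \<le> (\<integral>\<^sup>+e. ennreal c * ennreal e + ?F \<partial>exp1)"
  proof (rule nn_integral_mono_AE, use AE_exp1_nonneg in eventually_elim)
    fix e :: real assume "0 \<le> e"
    then have ce: "0 \<le> c * e" using c by simp
    have "(\<integral>\<^sup>+s. (if s < c * e then 1 else f (s - c * e)) * indicator {0..T} s \<partial>lborel)
        \<le> (\<integral>\<^sup>+s. indicator {0..c * e} s + f (s - c * e) * indicator {0..T} (s - c * e) \<partial>lborel)"
      using ce by (intro nn_integral_mono) (auto simp: indicator_def)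
    also have "\<dots> = ennreal (c * e) + (\<integral>\<^sup>+s. f (s - c * e) * indicator {0..T} (s - c * e) \<partial>lborel)"
      using ce by (subst nn_integral_add) auto
    also have "(\<integral>\<^sup>+s. f (s - c * e) * indicator {0..T} (s - c * e) \<partial>lborel) = ?F"
      using nn_integral_real_affine[of "\<lambda>s. f s * indicator {0..T} s" 1 "- (c * e)"] by simp
    finally show "(\<integral>\<^sup>+s. (if s < c * e then 1 else f (s - c * e)) * indicator {0..T} s \<partial>lborel) \<le> ennreal c * ennreal e + ?F"
      using c \<open>0 \<le> e\<close> by (simp add: ennreal_mult)
  qed
  also have "\<dots> = ennreal c + ?F"
    using E.emeasure_space_1
    by (subst nn_integral_add) (auto simp: nn_integral_cmult nn_integral_exp1)
  finally show ?thesis .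
qed

lemma push_half_add:
  assumes [measurable]: "f \<in> borel_measurable borel" "f' \<in> borel_measurable borel"
  shows "push c 0 (\<lambda>s. (f s + f' s) / 2) t = (push c 0 f t + push c 0 f' t) / 2"
proof -
  have "push c 0 (\<lambda>s. (f s + f' s) / 2) t = push c 0 (\<lambda>s. f s + f' s) t / 2"
    unfolding push_def by (subst nn_integral_divide[symmetric]) (auto intro!: nn_integral_cong)
  then show ?thesis using push_add[OF assms, of c 0 0] by simp
qed

lemma half_add_ennreal: "0 \<le> u \<Longrightarrow> 0 \<le> v \<Longrightarrow> (ennreal u + ennreal v) / 2 = ennreal ((u + v) / 2)"
  by (subst ennreal_plus[symmetric]) (simp_all add: ennreal_divide_numeral del: ennreal_plus)

lemma half_add_mono: "a \<le> a' \<Longrightarrow> b \<le> b' \<Longrightarrow> (a + b) / 2 \<le> (a' + b') / (2::ennreal)"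
  by (intro divide_right_mono_ennreal add_mono)

lemma half_add_self: "(a + a) / 2 = (a::ennreal)"
  by (subst mult_2_right[symmetric], rule ennreal_mult_divide_eq) auto

section \<open>Path space, first-jump decomposition and measurability\<close>

abbreviation (input) shift :: "(nat \<Rightarrow> 'a) \<Rightarrow> nat \<Rightarrow> 'a" where
  "shift \<omega> \<equiv> \<lambda>k. \<omega> (Suc k)"

lemma walk_Suc: "walk \<omega> (Suc n) = fst (\<omega> 0) + walk (shift \<omega>) n"
  unfolding walk_def by (rule sum.lessThan_Suc_shift)

text \<open>A chain started at \<open>x\<close> is encoded as a chain from 0 in the landscape
  recentred at \<open>x\<close>; a first jump therefore shifts path and landscape together.\<close>

lemma jumptime_Suc:
  "jumptime (\<lambda>z. \<sigma> (x + z)) \<omega> (Suc n) =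
    \<sigma> x * snd (\<omega> 0) + jumptime (\<lambda>z. \<sigma> (x + fst (\<omega> 0) + z)) (shift \<omega>) n"
  unfolding jumptime_def walk_Suc sum.lessThan_Suc_shift
  by (simp add: walk_def[of _ 0] add.assoc)

lemma sets_path_space [measurable_cong]:
  "sets path_space = sets (PiM UNIV (\<lambda>_::nat. count_space UNIV \<Otimes>\<^sub>M borel))"
  unfolding path_space_def by (intro sets_PiM_cong sets_step_law refl)

lemma space_path_space [simp]: "space path_space = UNIV"
  using sets_eq_imp_space_eq[OF sets_path_space] by (auto simp: space_PiM space_pair_measure)

lemma prob_space_path_space: "prob_space path_space"
  unfolding path_space_def by (intro prob_space_PiM prob_space_step_law)

text \<open>An i.i.d. sequence is its first entry followed by an independent copy of the whole
  sequence; this serves as the Markov property at the first jump.\<close>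

lemma emeasure_path_space_Suc:
  assumes [measurable]: "A \<in> sets path_space"
  shows "emeasure path_space A = (\<integral>\<^sup>+y. emeasure path_space {\<omega>. case_nat y \<omega> \<in> A} \<partial>step_law)"
proof -
  interpret S: sequence_space step_law
    by (simp add: sequence_space_def product_prob_space_def product_prob_space_axioms_def
        product_sigma_finite_def prob_space_step_law prob_space_imp_sigma_finite)
  interpret P: prob_space path_space by (rule prob_space_path_space)
  have [measurable]: "(\<lambda>(s, \<omega>). case_nat s \<omega>) \<in> step_law \<Otimes>\<^sub>M path_space \<rightarrow>\<^sub>M path_space"
    unfolding path_space_def by measurable
  have "emeasure path_space A = emeasure (distr (step_law \<Otimes>\<^sub>M path_space) path_space (\<lambda>(s, \<omega>). case_nat s \<omega>)) A"
    using S.PiM_iter by (simp add: path_space_def)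
  also have "\<dots> = emeasure (step_law \<Otimes>\<^sub>M path_space) ((\<lambda>(s, \<omega>). case_nat s \<omega>) -` A \<inter> space (step_law \<Otimes>\<^sub>M path_space))"
    by (rule emeasure_distr) auto
  also have "\<dots> = (\<integral>\<^sup>+y. emeasure path_space (Pair y -` ((\<lambda>(s, \<omega>). case_nat s \<omega>) -` A \<inter> space (step_law \<Otimes>\<^sub>M path_space))) \<partial>step_law)"
    by (rule P.emeasure_pair_measure_alt) measurable
  also have "\<dots> = (\<integral>\<^sup>+y. emeasure path_space {\<omega>. case_nat y \<omega> \<in> A} \<partial>step_law)"
    by (intro nn_integral_cong arg_cong[where f="emeasure path_space"]) (auto simp: space_pair_measure)
  finally show ?thesis .
qed

lemma measurable_walk [measurable]: "(\<lambda>\<omega>. walk \<omega> n) \<in> path_space \<rightarrow>\<^sub>M count_space UNIV"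
proof (induction n)
  case (Suc n)
  have "(\<lambda>\<omega>. walk \<omega> n + fst (\<omega> n)) \<in> path_space \<rightarrow>\<^sub>M count_space UNIV"
    using Suc by measurable
  then show ?case by (simp add: walk_def add.commute)
qed (simp add: walk_def)

lemma measurable_jumptime [measurable]: "(\<lambda>\<omega>. jumptime \<sigma> \<omega> n) \<in> borel_measurable path_space"
  unfolding jumptime_def by measurable

lemma measurable_btm [measurable]: "(\<lambda>\<omega>. btm \<sigma> \<omega> t) \<in> path_space \<rightarrow>\<^sub>M count_space UNIV"
  unfolding btm_def by measurable

section \<open>The quenched estimate\<close>

text \<open>A nonzero slope of a convex function persists in one of the two directions and forces
  linear growth there, against the bound by 1.\<close>

lemma bounded_convex_int_const:
  fixes f :: "int \<Rightarrow> real"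
  assumes convex: "\<And>x. f x - f (x - 1) \<le> f (x + 1) - f x" and bounded: "\<And>x. 0 \<le> f x" "\<And>x. f x \<le> 1"
  shows "f (x + 1) = f x"
proof -
  define d where "d x = f (x + 1) - f x" for x
  have mono: "d x \<le> d (x + int k)" for x k
  proof (induction k)
    case (Suc k)
    then show ?case using convex[of "x + int k + 1"] by (simp add: d_def algebra_simps)
  qed simp
  have right: "f x + real k * d x \<le> f (x + int k)" for k
  proof (induction k)
    case (Suc k)
    then show ?case using mono[of x k] by (simp add: d_def algebra_simps)
  qed simp
  have left: "f (x + 1) - real k * d x \<le> f (x + 1 - int k)" for k
  proof (induction k)
    case (Suc k)
    then show ?case using mono[of "x - int k" k] by (simp add: d_def algebra_simps)
  qed simp
  have bound: "real k * \<bar>d x\<bar> \<le> 1" for k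
    using right[of k] left[of k] bounded[of "x + int k"] bounded[of "x + 1 - int k"] bounded[of x] bounded[of "x + 1"]
    by (auto simp: abs_if)
  have "d x = 0"
  proof (rule ccontr)
    assume "d x \<noteq> 0"
    then obtain k where "1 < real k * \<bar>d x\<bar>" using reals_Archimedean3[of "\<bar>d x\<bar>"] by auto
    with bound[of k] show False by simp
  qed
  then show ?thesis by (simp add: d_def)
qed

locale trap =
  fixes \<sigma> :: "int \<Rightarrow> real" and \<Gamma> :: "int set"
  assumes pos: "\<And>z. 0 < \<sigma> z" and finite_\<Gamma>: "finite \<Gamma>"
begin

text \<open>\<open>bad n x t \<omega>\<close>: started at \<open>x\<close>, the chain is outside \<open>\<Gamma>\<close> at time \<open>t\<close> or has made \<open>n\<close> jumps by then.\<close>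

primrec bad :: "nat \<Rightarrow> int \<Rightarrow> real \<Rightarrow> (nat \<Rightarrow> int \<times> real) \<Rightarrow> bool" where
  "bad 0 x t \<omega> = True"
| "bad (Suc n) x t \<omega> = (if t < \<sigma> x * snd (\<omega> 0) then x \<notin> \<Gamma>
     else bad n (x + fst (\<omega> 0)) (t - \<sigma> x * snd (\<omega> 0)) (shift \<omega>))"

text \<open>The recursion of a path that is not bad stops at the first holding interval ending after
  \<open>t\<close>, whose index is the \<open>LEAST\<close> in the definition of
  \<open>btm\<close>.\<close>

lemma not_bad_imp:
  "\<not> bad n x t \<omega> \<Longrightarrow> \<exists>m. t < jumptime (\<lambda>z. \<sigma> (x + z)) \<omega> (Suc m) \<and>
    (\<forall>j<m. \<not> t < jumptime (\<lambda>z. \<sigma> (x + z)) \<omega> (Suc j)) \<and> x + walk \<omega> m \<in> \<Gamma>"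
proof (induction n arbitrary: x t \<omega>)
  case (Suc n)
  show ?case
  proof (cases "t < \<sigma> x * snd (\<omega> 0)")
    case True
    then show ?thesis using Suc.prems
      by (intro exI[of _ 0]) (auto simp: jumptime_Suc walk_def jumptime_def)
  next
    case False
    then obtain m where m: "t - \<sigma> x * snd (\<omega> 0) < jumptime (\<lambda>z. \<sigma> (x + fst (\<omega> 0) + z)) (shift \<omega>) (Suc m)"
      "\<And>j. j < m \<Longrightarrow> \<not> t - \<sigma> x * snd (\<omega> 0) < jumptime (\<lambda>z. \<sigma> (x + fst (\<omega> 0) + z)) (shift \<omega>) (Suc j)"
      "x + fst (\<omega> 0) + walk (shift \<omega>) m \<in> \<Gamma>"
      using Suc.IH Suc.prems by fastforce
    have "\<not> t < jumptime (\<lambda>z. \<sigma> (x + z)) \<omega> (Suc j)" if "j < Suc m" for j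
      using that m(2) False by (cases j) (force simp: jumptime_Suc jumptime_def[of _ _ 0])+
    then show ?thesis
      using m by (intro exI[of _ "Suc m"]) (auto simp: jumptime_Suc[of _ _ _ "Suc _"] walk_Suc add.assoc)
  qed
qed simp

text \<open>On a path that explodes before \<open>t\<close> the \<open>LEAST\<close> in
  \<open>btm\<close> has no witness and an unspecified value; such a path is bad for every
  \<open>n\<close>, so it is covered too.\<close>

lemma bad_if_btm_notin:
  assumes "btm \<sigma> \<omega> t \<notin> \<Gamma>"
  shows "bad n 0 t \<omega>"
proof (rule ccontr)
  assume "\<not> bad n 0 t \<omega>"
  from not_bad_imp[OF this] obtain m where m: "t < jumptime \<sigma> \<omega> (Suc m)"
    "\<And>j. j < m \<Longrightarrow> \<not> t < jumptime \<sigma> \<omega> (Suc j)" "walk \<omega> m \<in> \<Gamma>"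
    by auto
  then have "(LEAST n. t < jumptime \<sigma> \<omega> (Suc n)) = m"
    by (intro Least_equality) (auto simp: not_le[symmetric])
  with m(3) assms show False by (simp add: btm_def)
qed

text \<open>Measurability is joint because the recursion evaluates \<open>bad n\<close> at a random
  site and a random remaining time.\<close>

lemma measurable_bad:
  "Measurable.pred (count_space UNIV \<Otimes>\<^sub>M (borel \<Otimes>\<^sub>M path_space)) (\<lambda>(x, t, \<omega>). bad n x t \<omega>)"
proof (induction n)
  case (Suc n)
  have [measurable]: "shift \<in> path_space \<rightarrow>\<^sub>M path_space"
    unfolding path_space_def by (rule measurable_PiM_single') (auto simp: space_PiM intro: PiE_mem)
  let ?g = "\<lambda>(x::int, t, \<omega>::nat \<Rightarrow> int \<times> real). (x + fst (\<omega> 0), t - \<sigma> x * snd (\<omega> 0), shift \<omega>)"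
  have g[measurable]: "?g \<in> count_space UNIV \<Otimes>\<^sub>M (borel \<Otimes>\<^sub>M path_space) \<rightarrow>\<^sub>M count_space UNIV \<Otimes>\<^sub>M (borel \<Otimes>\<^sub>M path_space)"
    by measurable
  define Q where "Q = (\<lambda>(x, t, \<omega>). bad n (x + fst (\<omega> 0)) (t - \<sigma> x * snd (\<omega> 0)) (shift \<omega>))"
  have [measurable]: "Measurable.pred (count_space UNIV \<Otimes>\<^sub>M (borel \<Otimes>\<^sub>M path_space)) Q"
    using measurable_compose[OF g Suc] by (simp add: case_prod_beta' Q_def)
  have "(\<lambda>(x, t, \<omega>). bad (Suc n) x t \<omega>) =
      (\<lambda>y. if fst (snd y) < \<sigma> (fst y) * snd (snd (snd y) 0) then fst y \<notin> \<Gamma> else Q y)"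
    by (auto simp: Q_def fun_eq_iff)
  also have "Measurable.pred (count_space UNIV \<Otimes>\<^sub>M (borel \<Otimes>\<^sub>M path_space)) \<dots>"
    by measurable
  finally show ?case .
qed simp

section \<open>First-step recursions and the excursion bound\<close>

definition bad_prob :: "nat \<Rightarrow> int \<Rightarrow> real \<Rightarrow> ennreal" where
  "bad_prob n x t = emeasure path_space {\<omega>. bad n x t \<omega>}"

lemma bad_prob_0: "bad_prob 0 x t = 1"
  using prob_space.emeasure_space_1[OF prob_space_path_space] by (simp add: bad_prob_def)

lemma measurable_bad_single [measurable]: "Measurable.pred path_space (bad n x t)"
  using measurable_compose[OF _ measurable_bad, of "\<lambda>\<omega>. (x, t, \<omega>)" path_space n] by simp

lemma sets_bad [measurable]: "{\<omega>. bad n x t \<omega>} \<in> sets path_space"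
  using measurable_bad_single[of n x t] by (simp add: pred_def)

lemma measurable_bad_prob: "(\<lambda>(x, t). bad_prob n x t) \<in> borel_measurable (count_space UNIV \<Otimes>\<^sub>M borel)"
proof -
  interpret P: prob_space path_space by (rule prob_space_path_space)
  have "Measurable.pred ((count_space UNIV \<Otimes>\<^sub>M borel) \<Otimes>\<^sub>M path_space) (\<lambda>((x, t), \<omega>). bad n x t \<omega>)"
    using measurable_compose[OF _ measurable_bad, of "\<lambda>((x, t), \<omega>). (x, t, \<omega>)" _ n] by (simp add: case_prod_beta')
  then have "{((x, t), \<omega>). bad n x t \<omega>} \<in> sets ((count_space UNIV \<Otimes>\<^sub>M borel) \<Otimes>\<^sub>M path_space)"
    by (simp add: pred_def space_pair_measure)
  from P.measurable_emeasure_Pair[OF this] show ?thesis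
    by (simp add: bad_prob_def case_prod_beta' vimage_def)
qed

lemma measurable_bad_prob_single [measurable]: "bad_prob n x \<in> borel_measurable borel"
  using measurable_compose[OF _ measurable_bad_prob, of "\<lambda>t. (x, t)" borel n] by simp

lemma bad_prob_Suc:
  "bad_prob (Suc n) x t = (push (\<sigma> x) (indicator (- \<Gamma>) x) (bad_prob n (x + 1)) t + push (\<sigma> x) (indicator (- \<Gamma>) x) (bad_prob n (x - 1)) t) / 2"
proof -
  have "bad_prob (Suc n) x t = (\<integral>\<^sup>+y. emeasure path_space {\<omega>. bad (Suc n) x t (case_nat y \<omega>)} \<partial>step_law)"
    unfolding bad_prob_def by (subst emeasure_path_space_Suc[OF sets_bad]) simp
  also have "\<dots> = (\<integral>\<^sup>+y. (if t < \<sigma> x * snd y then indicator (- \<Gamma>) x else bad_prob n (x + fst y) (t - \<sigma> x * snd y)) \<partial>step_law)"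
    using prob_space.emeasure_space_1[OF prob_space_path_space]
    by (intro nn_integral_cong) (auto simp: bad_prob_def indicator_def)
  also have "\<dots> = (push (\<sigma> x) (indicator (- \<Gamma>) x) (bad_prob n (x + 1)) t + push (\<sigma> x) (indicator (- \<Gamma>) x) (bad_prob n (x - 1)) t) / 2"
  proof -
    have [measurable]: "(\<lambda>y. bad_prob n (x + fst y) (t - \<sigma> x * snd y)) \<in> borel_measurable (count_space UNIV \<Otimes>\<^sub>M borel)"
      using measurable_compose[OF _ measurable_bad_prob, of "\<lambda>y. (x + fst y, t - \<sigma> x * snd y)"] by simp
    have "(\<lambda>y. if t < \<sigma> x * snd y then indicator (- \<Gamma>) x else bad_prob n (x + fst y) (t - \<sigma> x * snd y))
        \<in> borel_measurable (count_space UNIV \<Otimes>\<^sub>M borel)"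
      by measurable
    from nn_integral_step_law[OF this] show ?thesis
      unfolding push_def by (simp cong: if_cong)
  qed
  finally show ?thesis .
qed

text \<open>\<open>survive n x t\<close>: started at \<open>x\<close>, the chain avoids \<open>\<Gamma>\<close> up to time \<open>t\<close> while making fewer than \<open>n\<close> jumps.\<close>

primrec survive :: "nat \<Rightarrow> int \<Rightarrow> real \<Rightarrow> ennreal" where
  "survive 0 x = (\<lambda>_. 0)"
| "survive (Suc n) x = (\<lambda>t. if x \<in> \<Gamma> then 0
     else (push (\<sigma> x) 1 (survive n (x + 1)) t + push (\<sigma> x) 1 (survive n (x - 1)) t) / 2)"

lemma measurable_survive [measurable]: "survive n x \<in> borel_measurable borel"
  by (induction n arbitrary: x) simp_all

lemma survive_\<Gamma>: "x \<in> \<Gamma> \<Longrightarrow> survive n x t = 0"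
  by (cases n) auto

lemma survive_le_1: "survive n x t \<le> 1"
proof (induction n arbitrary: x t)
  case (Suc n)
  have p: "push (\<sigma> x) 1 (survive n y) t \<le> 1" for y
  proof -
    have "push (\<sigma> x) 1 (survive n y) t \<le> push (\<sigma> x) 1 (\<lambda>_. 1) t"
      using Suc pos by (intro push_mono) auto
    then show ?thesis by (simp add: push_const)
  qed
  from half_add_mono[OF p p] show ?case by (simp add: half_add_self)
qed simp

lemma survive_antimono: "0 \<le> s \<Longrightarrow> s \<le> t \<Longrightarrow> survive n x t \<le> survive n x s"
proof (induction n arbitrary: x s t)
  case (Suc n)
  then show ?case using pos survive_le_1
    by (auto intro!: half_add_mono push_antimono)
qed simp

lemma survive_Suc_mono: "survive n x t \<le> survive (Suc n) x t"
proof (induction n arbitrary: x t)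
  case (Suc n)
  then show ?case using pos
    by (auto simp del: survive.simps(2) simp add: survive.simps(2)[of "Suc n"] survive.simps(2)[of n]
        intro!: half_add_mono push_mono)
qed simp

text \<open>\<open>laplace n x\<close> is the Laplace transform at 1 of the \<open>n\<close>-th jump time; its decay rules out explosion.\<close>

primrec laplace :: "nat \<Rightarrow> int \<Rightarrow> real" where
  "laplace 0 x = 1"
| "laplace (Suc n) x = (laplace n (x + 1) + laplace n (x - 1)) / (2 * (1 + \<sigma> x))"

lemma laplace_nonneg: "0 \<le> laplace n x"
  using pos by (induction n arbitrary: x) (auto simp: less_imp_le add_nonneg_nonneg)

text \<open>Excursions leave \<open>z\<close> at rate at most \<open>1 / \<sigma> z\<close>, to
  either neighbour with probability 1/2; a summand is this rate times the probability that the
  excursion outlasts \<open>s\<close> with fewer than \<open>n\<close> jumps. Integrating over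
  \<open>s\<close> in \<open>[0, t]\<close> gives the truncated mean durations.\<close>

definition excursion_rate :: "nat \<Rightarrow> real \<Rightarrow> ennreal" where
  "excursion_rate n s = (\<Sum>z\<in>\<Gamma>. (survive n (z + 1) s + survive n (z - 1) s) / 2 / ennreal (\<sigma> z))"

definition excursion_prob :: "nat \<Rightarrow> real \<Rightarrow> ennreal" where
  "excursion_prob n t = (\<integral>\<^sup>+s. excursion_rate n s * indicator {0..t} s \<partial>lborel)"

lemma measurable_excursion_rate [measurable]: "excursion_rate n \<in> borel_measurable borel"
  unfolding excursion_rate_def by measurable

lemma measurable_excursion_prob [measurable]: "excursion_prob n \<in> borel_measurable borel"
  unfolding excursion_prob_def atLeastAtMost_iff indicator_def by measurable

lemma excursion_prob_mono: "s \<le> t \<Longrightarrow> excursion_prob n s \<le> excursion_prob n t"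
  unfolding excursion_prob_def by (intro nn_integral_mono mult_left_mono) (auto simp: indicator_def)

lemma excursion_prob_Suc_mono: "excursion_prob n t \<le> excursion_prob (Suc n) t"
  unfolding excursion_prob_def excursion_rate_def
  by (intro nn_integral_mono mult_right_mono sum_mono divide_right_mono_ennreal half_add_mono survive_Suc_mono) auto

text \<open>By induction on the number of jumps, the right-hand side is a supersolution of the
  recursion \<open>bad_prob_Suc\<close>. Its terms account for not having reached \<Gamma>, for
  being on an excursion from it, and for making \<open>n\<close> jumps by time
  \<open>t\<close>.\<close>

lemma bad_prob_le:
  "0 \<le> t \<Longrightarrow> bad_prob n x t \<le> survive n x t + (excursion_prob n t + ennreal (exp t * laplace n x))"
proof (induction n arbitrary: x t)
  case 0
  then show ?case by (simp add: bad_prob_0) (metis add_increasing le_add2 ennreal_leI ennreal_1 one_le_exp_iff zero_le order_trans)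
next
  case (Suc n)
  let ?a = "indicator (- \<Gamma>) x :: ennreal" and ?c = "\<sigma> x"
  have c: "0 < ?c" by (rule pos)
  have split: "push ?c ?a (bad_prob n y) t \<le> push ?c ?a (survive n y) t + (push ?c 0 (excursion_prob n) t + ennreal (exp t * (laplace n y / (1 + ?c))))" for y
  proof -
    have "push ?c ?a (bad_prob n y) t \<le> push ?c (?a + (0 + 0)) (\<lambda>s. survive n y s + (excursion_prob n s + ennreal (exp s * laplace n y))) t"
      using Suc.IH c by (intro push_mono) auto
    also have "\<dots> = push ?c ?a (survive n y) t + (push ?c 0 (excursion_prob n) t + push ?c 0 (\<lambda>s. ennreal (exp s * laplace n y)) t)"
      by (subst push_add, measurable, subst push_add) auto
    also have "\<dots> \<le> push ?c ?a (survive n y) t + (push ?c 0 (excursion_prob n) t + ennreal (exp t * (laplace n y / (1 + ?c))))"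
      using push_exp_le[OF c laplace_nonneg] by (intro add_left_mono)
    finally show ?thesis .
  qed
  define A where "A = (push ?c ?a (survive n (x + 1)) t + push ?c ?a (survive n (x - 1)) t) / 2"
  define B where "B = push ?c 0 (excursion_prob n) t"
  define C where "C = (ennreal (exp t * (laplace n (x + 1) / (1 + ?c))) + ennreal (exp t * (laplace n (x - 1) / (1 + ?c)))) / 2"
  have "bad_prob (Suc n) x t \<le> A + (B + C)"
  proof -
    have "bad_prob (Suc n) x t \<le> ((push ?c ?a (survive n (x + 1)) t + (B + ennreal (exp t * (laplace n (x + 1) / (1 + ?c))))) +
       (push ?c ?a (survive n (x - 1)) t + (B + ennreal (exp t * (laplace n (x - 1) / (1 + ?c)))))) / 2"
      unfolding bad_prob_Suc B_def by (intro half_add_mono split)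
    also have "\<dots> = A + ((B + B) / 2 + C)"
      unfolding A_def C_def add_divide_distrib_ennreal by (simp add: ac_simps)
    finally show ?thesis by (simp add: half_add_self)
  qed
  moreover have "C = ennreal (exp t * laplace (Suc n) x)"
  proof -
    have "C = ennreal ((exp t * (laplace n (x + 1) / (1 + ?c)) + exp t * (laplace n (x - 1) / (1 + ?c))) / 2)"
      unfolding C_def using c laplace_nonneg[of n]
      by (subst ennreal_plus[symmetric]) (auto simp: divide_ennreal[symmetric] simp del: ennreal_plus)
    also have "\<dots> = ennreal (exp t * laplace (Suc n) x)"
      by (simp add: add_divide_distrib distrib_left mult.commute[of 2])
    finally show ?thesis .
  qed
  moreover have "A + B \<le> survive (Suc n) x t + excursion_prob (Suc n) t"
  proof (cases "x \<in> \<Gamma>")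
    \<comment> \<open>Outside \<Gamma>, \<open>A\<close> is \<open>survive (Suc n) x t\<close> by
      definition, and \<open>B\<close> is bounded by monotonicity because less time remains after
      the jump.\<close>
    case False
    have "B \<le> push ?c (excursion_prob n t) (\<lambda>_. excursion_prob n t) t"
      unfolding B_def using c by (intro push_mono excursion_prob_mono) auto
    then have "B \<le> excursion_prob (Suc n) t"
      using order_trans[OF _ excursion_prob_Suc_mono] by (simp add: push_const)
    with False show ?thesis by (auto simp: A_def intro!: add_mono)
  next
    \<comment> \<open>On \<Gamma>, \<open>A\<close> is the excursion that this jump starts; the
      renewal inequality absorbs it into \<open>excursion_prob n t\<close> together with
      \<open>B\<close>.\<close>
    case True
    have "A = push ?c 0 (\<lambda>s. (survive n (x + 1) s + survive n (x - 1) s) / 2) t"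
      unfolding A_def using True by (subst push_half_add) auto
    moreover have "push ?c 0 (\<lambda>s. (survive n (x + 1) s + survive n (x - 1) s) / 2) t + B \<le> excursion_prob n t"
      unfolding B_def excursion_prob_def
    proof (rule push_0_renewal)
      show "(survive n (x + 1) s + survive n (x - 1) s) / 2 / ennreal ?c \<le> excursion_rate n s" for s
        unfolding excursion_rate_def using True finite_\<Gamma>
        by (intro member_le_sum[where f="\<lambda>z. (survive n (z + 1) s + survive n (z - 1) s) / 2 / ennreal (\<sigma> z)"]) auto
    qed (use c in auto)
    ultimately show ?thesis
      using excursion_prob_Suc_mono[of n t] order_trans by (auto simp: add_increasing)
  qed
  ultimately show ?case
    by (metis (no_types, lifting) add.assoc add_right_mono order_trans)
qed

section \<open>Non-explosion and expected occupation times\<close>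

lemma laplace_le_1: "laplace n x \<le> 1"
proof (induction n arbitrary: x)
  case (Suc n)
  have "laplace n (x + 1) + laplace n (x - 1) \<le> 2 * (1 + \<sigma> x)"
    using Suc[of "x + 1"] Suc[of "x - 1"] pos[of x] by simp
  then show ?case using pos[of x] by (simp add: divide_le_eq)
qed simp

lemma laplace_Suc_le: "laplace (Suc n) x \<le> laplace n x"
proof (induction n arbitrary: x)
  case 0
  then show ?case using laplace_le_1[of "Suc 0"] by simp
next
  case (Suc n)
  show ?case
    using Suc[of "x + 1"] Suc[of "x - 1"] pos[of x]
    by (simp del: laplace.simps(2) add: laplace.simps(2)[of "Suc n"] laplace.simps(2)[of n x] divide_right_mono add_mono)
qed

text \<open>The decreasing limit \<open>l\<close> solves
  \<open>2 * (1 + \<sigma> x) * l x = l (x + 1) + l (x - 1)\<close>, so it is bounded and convex,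
  hence constant; then \<open>l x * \<sigma> x = 0\<close> forces \<open>l x = 0\<close>.\<close>

lemma laplace_tendsto_0: "(\<lambda>n. laplace n x) \<longlonglongrightarrow> 0"
proof -
  have "\<exists>l. (\<lambda>n. laplace n x) \<longlonglongrightarrow> l" for x
    by (meson decseq_convergent[of _ 0] decseq_SucI laplace_Suc_le laplace_nonneg)
  then obtain l where l: "\<And>x. (\<lambda>n. laplace n x) \<longlonglongrightarrow> l x" by metis
  have rec: "l x * (2 * (1 + \<sigma> x)) = l (x + 1) + l (x - 1)" for x
  proof -
    have "(\<lambda>n. laplace (Suc n) x) \<longlonglongrightarrow> (l (x + 1) + l (x - 1)) / (2 * (1 + \<sigma> x))"
      unfolding laplace.simps by (intro tendsto_intros l) (use pos[of x] in auto)
    then have "l x = (l (x + 1) + l (x - 1)) / (2 * (1 + \<sigma> x))"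
      using LIMSEQ_Suc[OF l[of x]] LIMSEQ_unique by blast
    then show ?thesis using pos[of x] by (simp add: field_simps)
  qed
  have l0: "0 \<le> l x" and l1: "l x \<le> 1" for x
    using l[of x] laplace_nonneg laplace_le_1 by (auto intro: LIMSEQ_le_const LIMSEQ_le_const2)
  have "l x - l (x - 1) \<le> l (x + 1) - l x" for x
    using rec[of x] mult_nonneg_nonneg[OF l0[of x], of "\<sigma> x"] pos[of x] by (simp add: algebra_simps)
  from bounded_convex_int_const[OF this l0 l1] have "l (x + 1) = l x" for x .
  from this[of x] this[of "x - 1"] rec[of x] have "l x * \<sigma> x = 0" by (simp add: algebra_simps)
  then have "l x = 0" using pos[of x] by simp
  with l[of x] show ?thesis by simp
qed

text \<open>Comparison principle for the expected time before \<Gamma> is reached, cut off at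
  \<open>T\<close>. That time never exceeds \<open>T\<close>, so the one-step inequality for
  \<open>g\<close> matters only where \<open>g\<close> is below \<open>T\<close>.\<close>

lemma occupation_le:
  fixes g :: "int \<Rightarrow> real"
  assumes nonneg: "\<And>x. 0 \<le> g x" and T: "0 \<le> T"
    and super: "\<And>x. x \<in> \<Gamma> \<or> T \<le> g x \<or> \<sigma> x + (g (x + 1) + g (x - 1)) / 2 \<le> g x"
  shows "(\<integral>\<^sup>+s. survive n x s * indicator {0..T} s \<partial>lborel) \<le> ennreal (g x)"
proof (induction n arbitrary: x)
  case (Suc n)
  let ?I = "\<lambda>f. \<integral>\<^sup>+s. f s * indicator {0..T} s \<partial>lborel"
  consider "x \<in> \<Gamma>" | "T \<le> g x" | "x \<notin> \<Gamma>" "\<sigma> x + (g (x + 1) + g (x - 1)) / 2 \<le> g x"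
    using super by blast
  then show ?case
  proof cases
    case 2
    have "?I (survive (Suc n) x) \<le> ?I (\<lambda>_. 1)"
      by (intro nn_integral_mono mult_right_mono survive_le_1) auto
    also have "\<dots> = ennreal T" using T by simp
    finally show ?thesis using 2 ennreal_leI order_trans by blast
  next
    case 3
    have p: "?I (push (\<sigma> x) 1 (survive n y)) \<le> ennreal (\<sigma> x + g y)" for y
      using order_trans[OF nn_integral_push_le[OF measurable_survive pos] add_left_mono[OF Suc[of y]]]
        pos[of x] nonneg[of y] by (simp add: less_imp_le)
    have "?I (survive (Suc n) x) = (?I (push (\<sigma> x) 1 (survive n (x + 1))) + ?I (push (\<sigma> x) 1 (survive n (x - 1)))) / 2"
      using 3(1) by (subst nn_integral_add[symmetric], measurable, subst nn_integral_divide[symmetric], measurable)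
        (auto intro!: nn_integral_cong simp: indicator_def)
    also have "\<dots> \<le> (ennreal (\<sigma> x + g (x + 1)) + ennreal (\<sigma> x + g (x - 1))) / 2"
      by (intro half_add_mono p)
    also have "\<dots> = ennreal (\<sigma> x + (g (x + 1) + g (x - 1)) / 2)"
      using nonneg[of "x + 1"] nonneg[of "x - 1"] pos[of x]
      by (subst half_add_ennreal) (auto simp: field_simps)
    also have "\<dots> \<le> ennreal (g x)" using 3(2) by (rule ennreal_leI)
    finally show ?thesis .
  qed simp
qed simp

text \<open>Markov's inequality for the hitting time of \<Gamma>, from monotonicity in time.\<close>

lemma survive_le_occupation:
  assumes "0 < t"
  shows "ennreal t * survive n x t \<le> (\<integral>\<^sup>+s. survive n x s * indicator {0..t} s \<partial>lborel)"
proof -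
  have "ennreal t * survive n x t = (\<integral>\<^sup>+s. survive n x t * indicator {0..t} s \<partial>lborel)"
    using assms by (subst nn_integral_cmult) (auto simp: mult.commute)
  also have "\<dots> \<le> (\<integral>\<^sup>+s. survive n x s * indicator {0..t} s \<partial>lborel)"
    by (intro nn_integral_mono) (auto simp: indicator_def intro!: survive_antimono)
  finally show ?thesis .
qed

text \<open>\<open>a\<close> bounds the truncated time to reach \<Gamma> from 0, and
  \<open>b z\<close> that from either neighbour of \<open>z\<close>. Both bounds are uniform in the
  number of jumps, so letting \<open>n\<close> tend to infinity removes the explosion term.\<close>

lemma btm_prob_ge:
  assumes t: "0 < t" and a: "0 \<le> a" and b: "\<And>z. z \<in> \<Gamma> \<Longrightarrow> 0 \<le> b z"
    and I0: "\<And>n. (\<integral>\<^sup>+s. survive n 0 s * indicator {0..t} s \<partial>lborel) \<le> ennreal a"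
    and I1: "\<And>n z. z \<in> \<Gamma> \<Longrightarrow> (\<integral>\<^sup>+s. survive n (z + 1) s * indicator {0..t} s \<partial>lborel) \<le> ennreal (b z)"
    and I2: "\<And>n z. z \<in> \<Gamma> \<Longrightarrow> (\<integral>\<^sup>+s. survive n (z - 1) s * indicator {0..t} s \<partial>lborel) \<le> ennreal (b z)"
  shows "btm_prob \<sigma> t \<Gamma> \<ge> 1 - (a / t + (\<Sum>z\<in>\<Gamma>. b z / \<sigma> z))"
proof -
  interpret P: prob_space path_space by (rule prob_space_path_space)
  have hit0: "survive n 0 t \<le> ennreal (a / t)" for n
  proof -
    have "survive n 0 t = ennreal t * survive n 0 t / ennreal t"
      using t by (subst mult.commute, subst ennreal_mult_divide_eq) auto
    also have "\<dots> \<le> ennreal a / ennreal t"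
      by (intro divide_right_mono_ennreal order_trans[OF survive_le_occupation[OF t] I0])
    finally show ?thesis using a t by (simp add: divide_ennreal)
  qed
  have "excursion_prob n t \<le> ennreal (\<Sum>z\<in>\<Gamma>. b z / \<sigma> z)" for n
  proof -
    have "excursion_prob n t = (\<integral>\<^sup>+s. (\<Sum>z\<in>\<Gamma>. (survive n (z + 1) s * indicator {0..t} s + survive n (z - 1) s * indicator {0..t} s) / 2 / ennreal (\<sigma> z)) \<partial>lborel)"
      unfolding excursion_prob_def excursion_rate_def by (intro nn_integral_cong) (auto simp: indicator_def)
    also have "\<dots> = (\<Sum>z\<in>\<Gamma>. ((\<integral>\<^sup>+s. survive n (z + 1) s * indicator {0..t} s \<partial>lborel)
        + (\<integral>\<^sup>+s. survive n (z - 1) s * indicator {0..t} s \<partial>lborel)) / 2 / ennreal (\<sigma> z))"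
      by (subst nn_integral_sum, measurable) (simp add: nn_integral_divide nn_integral_add)
    also have "\<dots> \<le> (\<Sum>z\<in>\<Gamma>. (ennreal (b z) + ennreal (b z)) / 2 / ennreal (\<sigma> z))"
      by (intro sum_mono divide_right_mono_ennreal half_add_mono I1 I2)
    also have "\<dots> = (\<Sum>z\<in>\<Gamma>. ennreal (b z / \<sigma> z))"
      by (intro sum.cong refl) (use b pos in \<open>auto simp: half_add_self divide_ennreal\<close>)
    also have "\<dots> = ennreal (\<Sum>z\<in>\<Gamma>. b z / \<sigma> z)"
      using b pos by (intro sum_ennreal) (auto simp: less_imp_le)
    finally show ?thesis .
  qed
  then have "bad_prob n 0 t \<le> ennreal (a / t) + (ennreal (\<Sum>z\<in>\<Gamma>. b z / \<sigma> z) + ennreal (exp t * laplace n 0))" for n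
    using t by (intro order_trans[OF bad_prob_le] add_mono hit0) auto
  moreover have nonneg: "0 \<le> a / t" "0 \<le> (\<Sum>z\<in>\<Gamma>. b z / \<sigma> z)" "0 \<le> exp t * laplace n 0" for n
    using a t b pos laplace_nonneg[of n 0] by (auto simp: less_imp_le intro!: sum_nonneg)
  ultimately have wn: "bad_prob n 0 t \<le> ennreal (a / t + (\<Sum>z\<in>\<Gamma>. b z / \<sigma> z) + exp t * laplace n 0)" for n
    by (simp add: ennreal_plus[symmetric] add.assoc del: ennreal_plus)
  have le: "measure path_space {\<omega>. btm \<sigma> \<omega> t \<notin> \<Gamma>} \<le> a / t + (\<Sum>z\<in>\<Gamma>. b z / \<sigma> z) + exp t * laplace n 0" for n
  proof -
    have "emeasure path_space {\<omega>. btm \<sigma> \<omega> t \<notin> \<Gamma>} \<le> bad_prob n 0 t"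
      unfolding bad_prob_def by (intro emeasure_mono) (auto simp: bad_if_btm_notin)
    from order_trans[OF this wn] show ?thesis
      using nonneg(1,2) nonneg(3)[of n] by (simp add: P.emeasure_eq_measure del: ennreal_plus)
  qed
  have "(\<lambda>n. a / t + (\<Sum>z\<in>\<Gamma>. b z / \<sigma> z) + exp t * laplace n 0) \<longlonglongrightarrow> a / t + (\<Sum>z\<in>\<Gamma>. b z / \<sigma> z) + exp t * 0"
    by (intro tendsto_intros laplace_tendsto_0)
  from LIMSEQ_le_const[OF this] le have "measure path_space {\<omega>. btm \<sigma> \<omega> t \<notin> \<Gamma>} \<le> a / t + (\<Sum>z\<in>\<Gamma>. b z / \<sigma> z)"
    by simp
  moreover have "{\<omega>. btm \<sigma> \<omega> t \<in> \<Gamma>} \<in> sets path_space"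
    using measurable_sets[OF measurable_btm[of \<sigma> t], of \<Gamma>] by (simp add: vimage_def)
  then have "btm_prob \<sigma> t \<Gamma> = 1 - measure path_space {\<omega>. btm \<sigma> \<omega> t \<notin> \<Gamma>}"
    using P.prob_compl[of "{\<omega>. btm \<sigma> \<omega> t \<in> \<Gamma>}"] by (simp add: btm_prob_def Compl_eq_Diff_UNIV[symmetric] Collect_neg_eq)
  ultimately show ?thesis by simp
qed

text \<open>\<open>2 min(i, j)\<close> is the Green function of simple random walk killed at \<open>0\<close>; the linear term accounts for
  leaving the box at its far end.\<close>

lemma occupation_side_le:
  fixes d a :: int and m j :: nat
  assumes d: "d = 1 \<or> d = -1" and a: "a \<in> \<Gamma>" and c: "0 \<le> c" and T: "0 \<le> T"
    and outer: "T \<le> c \<or> a + d * int m \<in> \<Gamma>" and m: "0 < m" and j: "j \<le> m"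
  shows "(\<integral>\<^sup>+s. survive n (a + d * int j) s * indicator {0..T} s \<partial>lborel)
    \<le> ennreal (c * j / m + (\<Sum>i=1..<m. 2 * real (min i j) * \<sigma> (a + d * int i)))"
proof -
  define f where "f k = c * real_of_int k / m + (\<Sum>i=1..<m. 2 * real_of_int (min (int i) k) * \<sigma> (a + d * int i))" for k :: int
  \<comment> \<open>Off the segment \<open>g\<close> equals \<open>T\<close>, so the trivial
    alternative of \<open>occupation_le\<close> holds there. The sign \<open>d\<close> orients the
    segment.\<close>
  define g where "g x = (let k = d * (x - a) in if 0 \<le> k \<and> k \<le> int m then f k else T)" for x :: int
  have f_nonneg: "0 \<le> f k" if "0 \<le> k" for k
    unfolding f_def using that c pos by (intro add_nonneg_nonneg sum_nonneg) (auto simp: less_imp_le)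
  have g: "g (a + d * k) = (if 0 \<le> k \<and> k \<le> int m then f k else T)" for k
    using d by (auto simp: g_def)
  have f_step: "\<sigma> (a + d * k) + (f (k + 1) + f (k - 1)) / 2 = f k" if k: "0 < k" "k < int m" for k
  proof -
    \<comment> \<open>The linear term is harmonic; the second difference of \<open>min i k\<close>
      in \<open>k\<close> is -1 at \<open>k = i\<close> and 0 elsewhere, and the factor 2 cancels
      the averaging.\<close>
    have "(f (k + 1) + f (k - 1)) / 2 - f k = (\<Sum>i=1..<m. (real_of_int (min (int i) (k + 1)) + real_of_int (min (int i) (k - 1))
        - 2 * real_of_int (min (int i) k)) * \<sigma> (a + d * int i))"
      using m by (simp add: f_def sum.distrib[symmetric] sum_subtractf[symmetric] sum_divide_distrib sum_distrib_left algebra_simps add_divide_distrib diff_divide_distrib)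
    also have "\<dots> = (\<Sum>i=1..<m. if i = nat k then - \<sigma> (a + d * int i) else 0)"
      using k by (intro sum.cong refl) (auto simp: min_def)
    also have "\<dots> = - \<sigma> (a + d * k)"
      using k by (subst sum.delta) auto
    finally show ?thesis by simp
  qed
  have "(\<integral>\<^sup>+s. survive n x s * indicator {0..T} s \<partial>lborel) \<le> ennreal (g x)" for x
  proof (rule occupation_le[OF _ T])
    show "0 \<le> g x" for x using f_nonneg T by (auto simp: g_def Let_def)
    show "x \<in> \<Gamma> \<or> T \<le> g x \<or> \<sigma> x + (g (x + 1) + g (x - 1)) / 2 \<le> g x" for x
    proof -
      define k where "k = d * (x - a)"
      have x: "x = a + d * k" using d by (auto simp: k_def)
      consider "k < 0 \<or> int m < k" | "k = 0" | "k = int m" | "0 < k" "k < int m" by linarith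
      then show ?thesis
      proof cases
        case 1 then show ?thesis by (auto simp: x g)
      next
        case 2 then show ?thesis using a x by simp
      next
        \<comment> \<open>At the far end either \<Gamma> is reached or the linear term alone equals
          \<open>c\<close>, which is at least \<open>T\<close>.\<close>
        case 3
        have "c \<le> f (int m)"
          unfolding f_def using m pos by (simp add: sum_nonneg less_imp_le)
        then show ?thesis using outer 3 unfolding x g by auto
      next
        case 4
        have x': "x + 1 = a + d * (k + d)" "x - 1 = a + d * (k - d)"
          using d by (auto simp: x)
        have "g (x + 1) + g (x - 1) = f (k + 1) + f (k - 1)"
          unfolding x' g using d 4 by auto
        moreover have "g x = f k" unfolding x g using 4 by auto
        ultimately show ?thesis using f_step[OF 4] x by simp
      qed
    qed
  qed
  from this[of "a + d * int j"] have "(\<integral>\<^sup>+s. survive n (a + d * int j) s * indicator {0..T} s \<partial>lborel) \<le> ennreal (f (int j))"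
    unfolding g using j by simp
  then show ?thesis by (simp add: f_def of_nat_min[symmetric])
qed

end

section \<open>Quenched bound for the two nearest deep traps\<close>

lemma btm_prob_pair_ge:
  fixes p q :: int and R b :: nat and D :: real
  assumes pos: "\<And>z. 0 < \<sigma> z" and t: "0 < t" and b: "0 < b" and M: "0 < M"
    and pq: "q \<le> 0" "0 < p" "- int R \<le> q"
    and trap: "M \<le> \<sigma> p" "M \<le> \<sigma> q"
    and inner: "(\<Sum>z\<in>{q<..<p}. \<sigma> z) \<le> D"
    and near: "\<And>z d. z \<in> {p, q} \<Longrightarrow> d = 1 \<or> d = -1 \<Longrightarrow> (\<Sum>i=1..<b. \<sigma> (z + d * int i)) \<le> D"
  shows "btm_prob \<sigma> t {p, q} \<ge> 1 - (2 * R * D / t + 2 * (t / b + 2 * D) / M)"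
proof -
  interpret trap \<sigma> "{p, q}" using pos by unfold_locales auto
  have D: "0 \<le> D" using inner pos by (meson less_imp_le order_trans sum_nonneg)
  define m j where "m = nat (p - q)" and "j = nat (- q)"
  \<comment> \<open>Both ends of the segment from \<open>q\<close> to \<open>p\<close> are targets,
    so \<open>c = 0\<close>; the start lies at distance \<open>j \<le> R\<close> from
    \<open>q\<close>, which bounds the Green function by \<open>2 * R\<close>.\<close>
  have start: "(\<integral>\<^sup>+s. survive n 0 s * indicator {0..t} s \<partial>lborel) \<le> ennreal (2 * R * D)" for n
  proof -
    have "(\<integral>\<^sup>+s. survive n (q + 1 * int j) s * indicator {0..t} s \<partial>lborel)
        \<le> ennreal (0 * real j / real m + (\<Sum>i=1..<m. 2 * real (min i j) * \<sigma> (q + 1 * int i)))"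
      using pq t by (intro occupation_side_le) (auto simp: m_def j_def)
    also have "\<dots> \<le> ennreal (\<Sum>i=1..<m. 2 * R * \<sigma> (q + int i))"
      using pos pq by (intro ennreal_leI) (auto intro!: sum_mono mult_right_mono simp: less_imp_le j_def)
    also have "(\<Sum>i=1..<m. 2 * R * \<sigma> (q + int i)) = 2 * R * (\<Sum>z\<in>{q<..<p}. \<sigma> z)"
      unfolding sum_distrib_left[symmetric]
      by (intro arg_cong2[where f="(*)"] refl sum.reindex_bij_witness[of _ "\<lambda>z. nat (z - q)" "\<lambda>i. q + int i"])
        (auto simp: m_def)
    also have "\<dots> \<le> 2 * R * D" by (intro mult_left_mono inner) auto
    finally show ?thesis using pq by (simp add: j_def ennreal_leI)
  qed
  \<comment> \<open>Next to a trap the segment is cut at distance \<open>b\<close> with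
    \<open>c = t\<close>; from distance 1 the linear term is \<open>t / b\<close> and every
    \<open>min i 1\<close> is 1.\<close>
  have side: "(\<integral>\<^sup>+s. survive n (z + d) s * indicator {0..t} s \<partial>lborel) \<le> ennreal (t / b + 2 * D)"
    if z: "z \<in> {p, q}" and d: "d = 1 \<or> d = -1" for n z d
  proof -
    have "(\<integral>\<^sup>+s. survive n (z + d * int 1) s * indicator {0..t} s \<partial>lborel)
        \<le> ennreal (t * real 1 / b + (\<Sum>i=1..<b. 2 * real (min i 1) * \<sigma> (z + d * int i)))"
      using z t b d by (intro occupation_side_le) auto
    also have "(\<Sum>i=1..<b. 2 * real (min i 1) * \<sigma> (z + d * int i)) = 2 * (\<Sum>i=1..<b. \<sigma> (z + d * int i))"
      unfolding sum_distrib_left by (intro sum.cong) (auto simp: min_def)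
    also have "ennreal (t * real 1 / b + 2 * (\<Sum>i=1..<b. \<sigma> (z + d * int i))) \<le> ennreal (t / b + 2 * D)"
      using near[OF z d] by (intro ennreal_leI) auto
    finally show ?thesis by simp
  qed
  have "1 - (2 * R * D / t + (\<Sum>z\<in>{p, q}. (t / b + 2 * D) / \<sigma> z)) \<le> btm_prob \<sigma> t {p, q}"
    using side[of _ 1] side[of _ "-1"] t D by (intro btm_prob_ge start) auto
  moreover have "(\<Sum>z\<in>{p, q}. (t / b + 2 * D) / \<sigma> z) \<le> (\<Sum>z\<in>{p, q}. (t / b + 2 * D) / M)"
    using t D trap M pos by (intro sum_mono divide_left_mono) (auto intro!: add_nonneg_nonneg)
  moreover have "(\<Sum>z\<in>{p, q}. (t / b + 2 * D) / M) = 2 * (t / b + 2 * D) / M"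
    using pq by simp
  ultimately show ?thesis by linarith
qed

text \<open>The hypotheses describe a good landscape. \<open>right\<close> and \<open>left\<close>
  give the \<open>LEAST\<close> and \<open>GREATEST\<close> in \<Gamma> their witnesses,
  \<open>gap\<close> makes both traps very deep, and \<open>trunc\<close> and \<open>sep\<close>
  control the shallow traps between and around them.\<close>

lemma btm_prob_Gamma_ge:
  fixes R b :: nat and D :: real
  assumes pos: "\<And>z. 0 < \<sigma> z" and t: "0 < t" and b: "0 < b" and l: "0 < ell \<mu> t" and C: "0 < C"
    and right: "\<exists>z\<in>{1..int R}. ell \<mu> t < \<sigma> z" and left: "\<exists>z\<in>{1 - int R..0}. ell \<mu> t < \<sigma> z"
    and gap: "\<And>z. z \<in> {- int R..int R} \<Longrightarrow> ell \<mu> t < \<sigma> z \<Longrightarrow> C * ell \<mu> t < \<sigma> z"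
    and trunc: "(\<Sum>z\<in>{- int (R + b)..int (R + b)}. \<sigma> z * indicator {0<..ell \<mu> t} (\<sigma> z)) \<le> D"
    and sep: "\<And>z i. z \<in> {- int (R + b)..int (R + b)} \<Longrightarrow> i \<in> {1..<b} \<Longrightarrow>
      ell \<mu> t < \<sigma> z \<Longrightarrow> \<not> ell \<mu> t < \<sigma> (z + int i)"
  shows "btm_prob \<sigma> t (Gamma \<mu> \<sigma> t) \<ge> 1 - (2 * R * D / t + 2 * (t / b + 2 * D) / (C * ell \<mu> t))"
proof -
  let ?l = "ell \<mu> t" and ?N = "{- int (R + b)..int (R + b)}"
  define p where "p = Min {z\<in>{1..int R}. ?l < \<sigma> z}"
  define q where "q = Max {z\<in>{1 - int R..0}. ?l < \<sigma> z}"
  have fin: "finite {z\<in>{1..int R}. ?l < \<sigma> z}" "finite {z\<in>{1 - int R..0}. ?l < \<sigma> z}"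
    by (rule finite_subset[OF Collect_restrict]; simp)+
  have "p \<in> {z\<in>{1..int R}. ?l < \<sigma> z}" unfolding p_def using right fin by (intro Min_in) blast+
  then have p: "1 \<le> p" "p \<le> int R" "?l < \<sigma> p" by auto
  have "q \<in> {z\<in>{1 - int R..0}. ?l < \<sigma> z}" unfolding q_def using left fin by (intro Max_in) blast+
  then have q: "1 - int R \<le> q" "q \<le> 0" "?l < \<sigma> q" by auto
  have p_le: "p \<le> z" if "0 < z" "?l < \<sigma> z" for z
  proof (cases "z \<le> int R")
    case True
    then show ?thesis unfolding p_def using that by (intro Min_le fin) auto
  qed (use p in auto)
  have q_ge: "z \<le> q" if "z \<le> 0" "?l < \<sigma> z" for z
  proof (cases "1 - int R \<le> z")
    case True
    then show ?thesis unfolding q_def using that by (intro Max_ge fin) auto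
  qed (use q in auto)
  have "Z1 \<mu> \<sigma> t = p" unfolding Z1_def using p p_le by (intro Least_equality) auto
  moreover have "Z2 \<mu> \<sigma> t = q" unfolding Z2_def using q q_ge by (intro Greatest_equality) auto
  ultimately have \<Gamma>: "Gamma \<mu> \<sigma> t = {p, q}" by (simp add: Gamma_def)
  have low: "(\<Sum>z\<in>A. \<sigma> z) \<le> D" if A: "A \<subseteq> ?N" "\<And>z. z \<in> A \<Longrightarrow> \<not> ?l < \<sigma> z" for A
  proof -
    have "(\<Sum>z\<in>A. \<sigma> z) = (\<Sum>z\<in>A. \<sigma> z * indicator {0<..?l} (\<sigma> z))"
      using A(2) pos by (intro sum.cong) (auto simp: indicator_def not_less)
    also have "\<dots> \<le> (\<Sum>z\<in>?N. \<sigma> z * indicator {0<..?l} (\<sigma> z))"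
      using A(1) pos by (intro sum_mono2) (auto simp: less_imp_le)
    finally show ?thesis using trunc by simp
  qed
  show ?thesis
    unfolding \<Gamma>
  proof (rule btm_prob_pair_ge[OF pos t b])
    show "(\<Sum>z\<in>{q<..<p}. \<sigma> z) \<le> D"
    proof (rule low)
      fix z assume "z \<in> {q<..<p}"
      then show "\<not> ?l < \<sigma> z" using p_le[of z] q_ge[of z] by (cases "0 < z") auto
    qed (use p q in auto)
    show "(\<Sum>i=1..<b. \<sigma> (z + d * int i)) \<le> D" if z: "z \<in> {p, q}" and d: "d = 1 \<or> d = -1" for z d
    proof -
      have "(\<Sum>i=1..<b. \<sigma> (z + d * int i)) = (\<Sum>z\<in>(\<lambda>i. z + d * int i) ` {1..<b}. \<sigma> z)"
        using d by (subst sum.reindex) (auto simp: inj_on_def)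
      also have "\<dots> \<le> D"
      proof (rule low)
        show "(\<lambda>i. z + d * int i) ` {1..<b} \<subseteq> ?N" using z d p q by auto
        fix y assume "y \<in> (\<lambda>i. z + d * int i) ` {1..<b}"
        then obtain i where i: "i \<in> {1..<b}" "y = z + d * int i" by auto
        have z': "z \<in> ?N" "y \<in> ?N" "?l < \<sigma> z" using z d i p q by auto
        \<comment> \<open>\<open>sep\<close> looks to the right only; for \<open>d = -1\<close> it
          is applied at \<open>y\<close>, where \<open>y + int i = z\<close>.\<close>
        then show "\<not> ?l < \<sigma> y"
          using d i sep[of z i] sep[of y i] by auto
      qed
      finally show ?thesis .
    qed
  qed (use p q gap[of p] gap[of q] l C in \<open>auto simp: less_imp_le\<close>)
qed

section \<open>Slowly varying tails\<close>

text \<open>The map \<open>x \<mapsto> 3 / 4 * x + \<eta>\<close> contracts to its fixed point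
  \<open>4 * \<eta>\<close>. Iterated over dyadic blocks, it leaves an error that is eventually
  below \<open>\<eta>\<close>.\<close>

lemma halving_contraction:
  fixes a :: "real \<Rightarrow> real"
  assumes u0: "0 < u0" and step: "\<And>u. u0 \<le> u \<Longrightarrow> a (2 * u) \<le> 3 / 4 * a u + \<eta>"
    and base: "\<And>u. u0 \<le> u \<Longrightarrow> u \<le> 2 * u0 \<Longrightarrow> a u \<le> A" and \<eta>: "0 < \<eta>" and A: "0 \<le> A"
  shows "\<forall>\<^sub>F u in at_top. a u \<le> 5 * \<eta>"
proof -
  have bound: "a u \<le> (3 / 4) ^ k * A + 4 * \<eta>" if "2 ^ k * u0 \<le> u" "u \<le> 2 * 2 ^ k * u0" for k u
    using that
  proof (induction k arbitrary: u)
    case 0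
    then show ?case using base[of u] \<eta> by simp
  next
    case (Suc k)
    have "1 \<le> (2::real) ^ k" by simp
    then have "u0 \<le> 2 ^ k * u0" using u0 by simp
    then have "a u \<le> 3 / 4 * a (u / 2) + \<eta>"
      using Suc.prems step[of "u / 2"] by simp
    moreover have "a (u / 2) \<le> (3 / 4) ^ k * A + 4 * \<eta>"
      using Suc.prems by (intro Suc.IH) auto
    ultimately show ?case by simp
  qed
  have "(\<lambda>k. (3 / 4 :: real) ^ k * A) \<longlonglongrightarrow> 0 * A"
    by (intro tendsto_mult_right LIMSEQ_realpow_zero) auto
  then have "\<forall>\<^sub>F k in sequentially. (3 / 4) ^ k * A < \<eta>"
    using \<eta> by (intro order_tendstoD(2)[of _ "0 * A"]) auto
  then obtain k0 where k0: "\<And>k. k0 \<le> k \<Longrightarrow> (3 / 4) ^ k * A < \<eta>"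
    by (auto simp: eventually_sequentially)
  have "a u \<le> 5 * \<eta>" if u: "2 ^ k0 * u0 \<le> u" for u
  proof -
    obtain n where "u / u0 < 2 ^ n" using real_arch_pow[of 2 "u / u0"] by auto
    then have n: "u < 2 ^ n * u0" using u0 by (simp add: field_simps)
    \<comment> \<open>For large \<open>u\<close> this least exponent is positive, and its
      predecessor is the index of the dyadic block containing \<open>u\<close>.\<close>
    define j where "j = (LEAST n. u < 2 ^ n * u0)"
    have j: "u < 2 ^ j * u0" unfolding j_def using n by (rule LeastI)
    have "k0 < j"
    proof (rule ccontr)
      assume "\<not> k0 < j"
      then have "(2::real) ^ j * u0 \<le> 2 ^ k0 * u0" using u0 by (intro mult_right_mono power_increasing) auto
      with j u show False by simp
    qed
    then obtain i where i: "j = Suc i" "k0 \<le> i" by (cases j) auto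
    have "\<not> u < 2 ^ i * u0" using not_less_Least[of i "\<lambda>n. u < 2 ^ n * u0"] i by (simp add: j_def)
    then have "a u \<le> (3 / 4) ^ i * A + 4 * \<eta>" using j i by (intro bound) auto
    with k0[OF i(2)] show ?thesis by simp
  qed
  then show ?thesis by (auto simp: eventually_at_top_linorder)
qed

text \<open>Meant for the probability that \<open>n\<close> independent sites hold no deep trap:
  \<open>(1 - p) ^ n \<le> exp (- (n * p))\<close>, then \<open>exp x \<ge> x\<close> at
  \<open>x = 1 / e\<close>.\<close>

lemma power_one_minus_le:
  fixes p e :: real and n :: nat
  assumes p: "0 \<le> p" "p \<le> 1" and e: "0 < e" and n: "1 / e \<le> n * p"
  shows "(1 - p) ^ n \<le> e"
proof -
  have "(1 - p) ^ n \<le> exp (- p) ^ n"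
    using p exp_ge_add_one_self[of "- p"] by (intro power_mono) auto
  also have "\<dots> = exp (- (n * p))" by (simp flip: exp_of_nat_mult)
  also have "\<dots> \<le> exp (- (1 / e))" using n by simp
  also have "\<dots> \<le> e"
  proof -
    have "1 / e \<le> exp (1 / e)" using exp_ge_add_one_self[of "1 / e"] by linarith
    then show ?thesis using e by (simp add: exp_minus field_simps)
  qed
  finally show ?thesis .
qed

locale slow_tail = prob_space \<mu> for \<mu> :: "real measure" +
  assumes sets_\<mu> [measurable_cong, simp]: "sets \<mu> = sets borel"
    and pos_\<mu>: "AE x in \<mu>. 0 < x"
    and slow: "slowly_varying (tailL \<mu>)"
begin

definition tail :: "real \<Rightarrow> real" where
  "tail u = measure \<mu> {u<..}"

lemma space_\<mu> [simp]: "space \<mu> = UNIV"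
  using sets_eq_imp_space_eq[OF sets_\<mu>] by simp

lemma tailL_eq: "tailL \<mu> u = 1 / tail u"
  by (simp add: tailL_def tail_def)

lemma tail_antimono: "u \<le> v \<Longrightarrow> tail v \<le> tail u"
  unfolding tail_def by (intro finite_measure_mono) auto

lemma tail_ratio: "0 < v \<Longrightarrow> ((\<lambda>u. tail u / tail (u * v)) \<longlongrightarrow> 1) at_top"
  using slow by (simp add: slowly_varying_def tailL_eq)

text \<open>If the tail vanished somewhere, its ratios would be \<open>0 / 0 = 0\<close> from there
  on and could not tend to 1.\<close>

lemma tail_pos: "0 < tail u"
proof (rule ccontr)
  assume "\<not> 0 < tail u"
  then have "tail u = 0" by (simp add: tail_def zero_less_measure_iff)
  then have z: "tail v = 0" if "u \<le> v" for v
    using tail_antimono[OF that] measure_nonneg[of \<mu>] by (simp add: tail_def order_antisym)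
  have "\<forall>\<^sub>F v in at_top. 0 < tail v / tail (v * 1)"
    using tail_ratio[of 1] by (rule order_tendstoD) auto
  moreover have "\<forall>\<^sub>F v in at_top. u \<le> v" by (rule eventually_ge_at_top)
  ultimately have "\<forall>\<^sub>F v::real in at_top. False" by eventually_elim (simp add: z)
  then show False by simp
qed

lemma tail_le_1: "tail u \<le> 1"
  by (simp add: tail_def)

lemma tail_eq_cdf: "tail u = 1 - cdf \<mu> u"
  using prob_compl[of "{..u}"] by (simp add: tail_def cdf_def Compl_eq_Diff_UNIV[symmetric] Compl_atMost)

sublocale real_distribution \<mu>
  by unfold_locales simp

lemma tail_tendsto_0: "(tail \<longlongrightarrow> 0) at_top"
  using tendsto_diff[OF tendsto_const[of 1] cdf_lim_at_top_prob] by (simp add: tail_eq_cdf[abs_def])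

lemma tail_right_continuous: "continuous (at_right u) tail"
  unfolding tail_eq_cdf[abs_def] by (intro continuous_intros cdf_is_right_cont)

section \<open>The depth scale \<open>ell\<close>\<close>

definition level_set :: "real \<Rightarrow> real set" where
  "level_set t = {s. 0 \<le> s \<and> t \<le> s * tailL \<mu> s}"

lemma level_mono: "0 \<le> s \<Longrightarrow> s \<le> s' \<Longrightarrow> s * tailL \<mu> s \<le> s' * tailL \<mu> s'"
  unfolding tailL_eq by (intro mult_mono divide_left_mono tail_antimono) (auto simp: tail_pos less_imp_le)

lemma level_nonempty: "0 \<le> t \<Longrightarrow> t \<in> level_set t"
  using tail_pos[of t] tail_le_1[of t] mult_left_mono[of 1 "1 / tail t" t]
  by (simp add: level_set_def tailL_eq)

lemma level_bdd: "bdd_below (level_set t)"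
  by (rule bdd_belowI[of _ 0]) (auto simp: level_set_def)

lemma ell_eq: "ell \<mu> t = Inf (level_set t)"
  by (simp add: ell_def level_set_def)

lemma less_level:
  assumes "0 \<le> s" "s < ell \<mu> t"
  shows "s * tailL \<mu> s < t"
  using assms cInf_lower[OF _ level_bdd, of s t] by (auto simp: ell_eq level_set_def not_le[symmetric])

text \<open>Every point above the infimum satisfies the inequality, and right continuity of the tail
  carries it to the infimum itself.\<close>

lemma level_ge:
  assumes "0 \<le> t"
  shows "t \<le> ell \<mu> t * tailL \<mu> (ell \<mu> t)"
proof -
  have n: "level_set t \<noteq> {}" using level_nonempty[OF assms] by auto
  have e: "0 \<le> ell \<mu> t" unfolding ell_eq by (rule cInf_greatest[OF n]) (simp add: level_set_def)
  have above: "t \<le> s * tailL \<mu> s" if s: "ell \<mu> t < s" for s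
  proof -
    obtain s' where "s' \<in> level_set t" "s' < s"
      using cInf_lessD[OF n, of s] s by (auto simp: ell_eq)
    then show ?thesis using level_mono[of s' s] by (auto simp: level_set_def)
  qed
  have "((\<lambda>s. s * tailL \<mu> s) \<longlongrightarrow> ell \<mu> t * tailL \<mu> (ell \<mu> t)) (at_right (ell \<mu> t))"
    using tail_right_continuous[of "ell \<mu> t"] tail_pos[of "ell \<mu> t"]
    unfolding tailL_eq continuous_within by (intro tendsto_intros) auto
  then show ?thesis
    by (rule tendsto_lowerbound) (auto simp: eventually_at_right_less above intro: eventually_mono[OF eventually_at_right_less])
qed

lemma ell_at_top: "filterlim (ell \<mu>) at_top at_top"
proof (rule filterlim_at_top_gt[where c=0, THEN iffD2], intro allI impI)
  fix B :: real assume B: "0 < B"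
  have "B \<le> ell \<mu> t" if t: "max 0 (B * tailL \<mu> B) < t" for t
    unfolding ell_eq
  proof (rule cInf_greatest)
    show "level_set t \<noteq> {}" using level_nonempty[of t] t by auto
    show "B \<le> s" if "s \<in> level_set t" for s
      using that t level_mono[of s B] by (cases "s \<le> B") (auto simp: level_set_def)
  qed
  then show "\<forall>\<^sub>F t in at_top. B \<le> ell \<mu> t"
    using eventually_gt_at_top[of "max 0 (B * tailL \<mu> B)"] by (rule eventually_mono[rotated])
qed

text \<open>Half of \<open>ell\<close> lies below the infimum, so its level is less than
  \<open>t\<close>. The factor 4 is 2 from the halving times 2 from slow variation between
  \<open>ell / 2\<close> and \<open>ell\<close>.\<close>

lemma ell_upper: "\<forall>\<^sub>F t in at_top. ell \<mu> t * tailL \<mu> (ell \<mu> t) \<le> 4 * t"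
proof -
  have "\<forall>\<^sub>F u in at_top. tail u / tail (u * 2) < 2"
    using tail_ratio[of 2] by (rule order_tendstoD) auto
  moreover have "filterlim (\<lambda>t. ell \<mu> t * (1 / 2)) at_top at_top"
    by (rule filterlim_at_top_mult_tendsto_pos[rotated 2, OF ell_at_top]) (auto intro: tendsto_const)
  ultimately have "\<forall>\<^sub>F t in at_top. tail (ell \<mu> t * (1 / 2)) / tail (ell \<mu> t * (1 / 2) * 2) < 2"
    using eventually_compose_filterlim by blast
  moreover have "\<forall>\<^sub>F t in at_top. 0 < ell \<mu> t"
    using ell_at_top by (simp add: filterlim_at_top_dense)
  ultimately show ?thesis
  proof eventually_elim
    case (elim t)
    define l where "l = ell \<mu> t"
    have l: "0 < l" using elim(2) by (simp add: l_def)
    have "l / 2 * tailL \<mu> (l / 2) < t"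
      using less_level[of "l / 2" t] l by (simp add: l_def)
    then have *: "l < 2 * t * tail (l / 2)"
      using tail_pos[of "l / 2"] by (simp add: tailL_eq divide_simps mult.commute)
    have t: "0 < t"
    proof (rule ccontr)
      assume "\<not> 0 < t"
      then have "2 * t * tail (l / 2) \<le> 0" using tail_pos[of "l / 2"] by (simp add: mult_le_0_iff)
      with * l show False by simp
    qed
    note *
    also have "2 * t * tail (l / 2) \<le> 2 * t * (2 * tail l)"
      using elim(1) tail_pos[of l] t by (intro mult_left_mono) (simp_all add: l_def divide_simps)
    finally show ?case using tail_pos[of l] by (simp add: tailL_eq divide_simps flip: l_def)
  qed
qed

section \<open>The truncated mean\<close>

definition trunc_mean :: "real \<Rightarrow> real" where
  "trunc_mean u = (\<integral>x. x * indicator {0<..u} x \<partial>\<mu>)"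

lemma integrable_trunc: "integrable \<mu> (\<lambda>x. x * indicator {0<..u} x)"
  by (rule integrable_const_bound[of _ "\<bar>u\<bar>"]) (auto simp: indicator_def)

lemma trunc_mean_nonneg: "0 \<le> trunc_mean u"
  unfolding trunc_mean_def by (intro integral_nonneg_AE) (auto simp: indicator_def)

lemma trunc_mean_le:
  assumes "0 \<le> u" shows "trunc_mean u \<le> u"
proof -
  have "trunc_mean u \<le> (\<integral>x. u \<partial>\<mu>)"
    unfolding trunc_mean_def using assms
    by (intro integral_mono integrable_trunc) (auto simp: indicator_def)
  then show ?thesis using prob_space by simp
qed

text \<open>The additional mass sits on \<open>{u<..2 * u}\<close>, where the variable is at most
  \<open>2 * u\<close>.\<close>

lemma trunc_mean_double:
  assumes "0 < u"
  shows "trunc_mean (2 * u) \<le> trunc_mean u + 2 * u * (tail u - tail (2 * u))"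
proof -
  have ind: "integrable \<mu> (indicator {v<..} :: real \<Rightarrow> real)" for v
    by (rule integrable_real_indicator) (simp_all add: emeasure_eq_measure)
  have I: "integrable \<mu> (\<lambda>x. 2 * u * (indicator {u<..} x - indicator {2 * u<..} x))"
    by (intro integrable_mult_right Bochner_Integration.integrable_diff ind)
  have "trunc_mean (2 * u) \<le> (\<integral>x. x * indicator {0<..u} x + 2 * u * (indicator {u<..} x - indicator {2 * u<..} x) \<partial>\<mu>)"
    unfolding trunc_mean_def
  proof (intro integral_mono Bochner_Integration.integrable_add integrable_trunc I)
    fix x show "x * indicator {0<..2 * u} x \<le> x * indicator {0<..u} x + 2 * u * (indicator {u<..} x - indicator {2 * u<..} x)"
      using assms by (auto simp: indicator_def)
  qed
  also have "\<dots> = trunc_mean u + (\<integral>x. 2 * u * (indicator {u<..} x - indicator {2 * u<..} x) \<partial>\<mu>)"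
    unfolding trunc_mean_def by (rule Bochner_Integration.integral_add[OF integrable_trunc I])
  also have "(\<integral>x. 2 * u * (indicator {u<..} x - indicator {2 * u<..} x) \<partial>\<mu>) = 2 * u * (tail u - tail (2 * u))"
    by (simp add: Bochner_Integration.integral_diff[OF ind ind] tail_def)
  finally show ?thesis .
qed

text \<open>A Karamata-type estimate: by the doubling inequality the quotient at
  \<open>2 * u\<close> is at most \<open>\<rho> / 2\<close> times that at \<open>u\<close> plus
  \<open>\<rho> - 1\<close>, where slow variation sends
  \<open>\<rho> = tail u / tail (2 * u)\<close> to 1.\<close>

lemma trunc_mean_small: "((\<lambda>u. trunc_mean u / (u * tail u)) \<longlongrightarrow> 0) at_top"
proof (rule tendstoI)
  fix e :: real assume e: "0 < e"
  \<comment> \<open>The bound 1/2 gives \<open>\<rho> / 2 \<le> 3 / 4\<close>, the contraction rate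
    required; the bound \<open>e / 6\<close> gives \<open>5 * \<eta> < e\<close>.\<close>
  define \<eta> where "\<eta> = min (1 / 2) (e / 6)"
  have \<eta>: "0 < \<eta>" "\<eta> \<le> 1 / 2" "5 * \<eta> < e" using e by (auto simp: \<eta>_def)
  let ?a = "\<lambda>u. trunc_mean u / (u * tail u)"
  have "\<forall>\<^sub>F u in at_top. tail u / tail (u * 2) < 1 + \<eta>"
    using tail_ratio[of 2] \<eta> by (intro order_tendstoD(2)[of _ 1]) auto
  then obtain u1 where u1: "\<And>u. u1 \<le> u \<Longrightarrow> tail u / tail (u * 2) < 1 + \<eta>"
    by (auto simp: eventually_at_top_linorder)
  define u0 where "u0 = max 1 u1"
  have "\<forall>\<^sub>F u in at_top. ?a u \<le> 5 * \<eta>"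
  proof (rule halving_contraction)
    show "0 < u0" by (simp add: u0_def)
    show "?a (2 * u) \<le> 3 / 4 * ?a u + \<eta>" if u: "u0 \<le> u" for u
    proof -
      have up: "0 < u" using u by (simp add: u0_def)
      define \<rho> where "\<rho> = tail u / tail (2 * u)"
      have \<rho>: "\<rho> \<le> 1 + \<eta>" using u1[of u] u by (simp add: u0_def \<rho>_def mult.commute)
      have "?a (2 * u) \<le> (trunc_mean u + 2 * u * (tail u - tail (2 * u))) / (2 * u * tail (2 * u))"
        using up tail_pos[of "2 * u"] by (intro divide_right_mono trunc_mean_double) auto
      also have "\<dots> = ?a u * (\<rho> / 2) + (\<rho> - 1)"
        using up tail_pos[of "2 * u"] tail_pos[of u] by (simp add: \<rho>_def field_simps)
      also have "\<dots> \<le> ?a u * (3 / 4) + \<eta>"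
        using \<rho> \<eta> up tail_pos[of u] trunc_mean_nonneg[of u] by (intro add_mono mult_left_mono) auto
      finally show ?thesis by simp
    qed
    show "?a u \<le> 1 / tail (2 * u0)" if u: "u0 \<le> u" "u \<le> 2 * u0" for u
    proof -
      have up: "0 < u" using u by (simp add: u0_def)
      have "?a u \<le> u / (u * tail u)"
        using up tail_pos[of u] trunc_mean_le[of u] by (intro divide_right_mono) auto
      also have "\<dots> = 1 / tail u" using up by simp
      also have "\<dots> \<le> 1 / tail (2 * u0)"
        using tail_antimono[OF u(2)] tail_pos by (intro divide_left_mono) auto
      finally show ?thesis .
    qed
  qed (use \<eta> tail_pos in \<open>auto simp: less_imp_le\<close>)
  moreover have "\<forall>\<^sub>F u::real in at_top. 0 < u" by (rule eventually_gt_at_top)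
  ultimately show "\<forall>\<^sub>F u in at_top. dist (?a u) 0 < e"
    by eventually_elim (use \<eta> trunc_mean_nonneg tail_pos in \<open>auto simp: less_imp_le abs_mult\<close>)
qed

section \<open>The random landscape\<close>

sublocale env: product_prob_space "\<lambda>_. \<mu>" "UNIV :: int set"
  by unfold_locales

lemma prob_space_env: "prob_space (env \<mu>)"
  unfolding env_def by (intro prob_space_PiM prob_space_axioms)

lemma space_env [simp]: "space (env \<mu>) = UNIV"
  by (auto simp: env_def space_PiM)

lemma sets_env [measurable_cong]: "sets (env \<mu>) = sets (PiM UNIV (\<lambda>_. borel))"
  unfolding env_def by (intro sets_PiM_cong) auto

lemma sets_env_Collect: "Measurable.pred (env \<mu>) P \<Longrightarrow> {\<sigma>. P \<sigma>} \<in> sets (env \<mu>)"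
  by (simp add: pred_def)

lemma measurable_coordinate [measurable]: "(\<lambda>\<sigma>. \<sigma> z) \<in> borel_measurable (env \<mu>)"
  by measurable

lemma prob_env_all:
  assumes "finite J" "\<And>z. z \<in> J \<Longrightarrow> A z \<in> sets borel"
  shows "measure (env \<mu>) {\<sigma>. \<forall>z\<in>J. \<sigma> z \<in> A z} = (\<Prod>z\<in>J. measure \<mu> (A z))"
proof -
  interpret E: prob_space "env \<mu>" by (rule prob_space_env)
  show ?thesis
    using env.emeasure_PiM_Collect[of J A] assms space_env
    by (simp add: env_def[symmetric] E.emeasure_eq_measure emeasure_eq_measure prod_ennreal measure_nonneg prod_nonneg)
qed

lemma prob_env_single:
  "A \<in> sets borel \<Longrightarrow> measure (env \<mu>) {\<sigma>. \<sigma> z \<in> A} = measure \<mu> A"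
  using prob_env_all[of "{z}" "\<lambda>_. A"] by simp

lemma prob_env_pair:
  "A \<in> sets borel \<Longrightarrow> B \<in> sets borel \<Longrightarrow> z \<noteq> z' \<Longrightarrow>
    measure (env \<mu>) {\<sigma>. \<sigma> z \<in> A \<and> \<sigma> z' \<in> B} = measure \<mu> A * measure \<mu> B"
  using prob_env_all[of "{z, z'}" "\<lambda>y. if y = z then A else B"] by simp

lemma AE_env_pos: "AE \<sigma> in env \<mu>. \<forall>z. 0 < \<sigma> z"
  unfolding AE_all_countable env_def
  by (intro allI AE_PiM_component prob_space_axioms pos_\<mu>) auto

text \<open>Markov's inequality: each site contributes \<open>trunc_mean l\<close> to the expected
  sum.\<close>

lemma prob_trunc_sum_le:
  assumes D: "0 < D"
  shows "measure (env \<mu>) {\<sigma>. D < (\<Sum>z\<in>J. \<sigma> z * indicator {0<..l} (\<sigma> z))} \<le> real (card J) * trunc_mean l / D"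
proof (cases "finite J")
  case True
  interpret E: prob_space "env \<mu>" by (rule prob_space_env)
  have comp: "distr (env \<mu>) \<mu> (\<lambda>\<sigma>. \<sigma> z) = \<mu>" for z
    using env.PiM_component[of z] by (simp add: env_def)
  have meas: "(\<lambda>\<sigma>. \<sigma> z) \<in> env \<mu> \<rightarrow>\<^sub>M \<mu>" for z
    unfolding env_def by measurable
  have int: "integrable (env \<mu>) (\<lambda>\<sigma>. \<sigma> z * indicator {0<..l} (\<sigma> z))" for z
    using integrable_trunc[of l] by (subst (asm) comp[of z, symmetric], subst (asm) integrable_distr_eq[OF meas]) auto
  have exp: "(\<integral>\<sigma>. \<sigma> z * indicator {0<..l} (\<sigma> z) \<partial>env \<mu>) = trunc_mean l" for z
    unfolding trunc_mean_def by (subst (2) comp[of z, symmetric], subst integral_distr[OF meas]) auto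
  have "measure (env \<mu>) {\<sigma>. D < (\<Sum>z\<in>J. \<sigma> z * indicator {0<..l} (\<sigma> z))}
      \<le> measure (env \<mu>) {\<sigma>\<in>space (env \<mu>). D \<le> (\<Sum>z\<in>J. \<sigma> z * indicator {0<..l} (\<sigma> z))}"
    unfolding space_env by (intro E.finite_measure_mono sets_env_Collect) (auto, measurable)
  also have "\<dots> \<le> (\<integral>\<sigma>. (\<Sum>z\<in>J. \<sigma> z * indicator {0<..l} (\<sigma> z)) \<partial>env \<mu>) / D"
    using D by (intro integral_Markov_inequality_measure[where A="{}"] Bochner_Integration.integrable_sum int)
      (auto intro!: sum_nonneg simp: indicator_def)
  also have "\<dots> = real (card J) * trunc_mean l / D"
    by (subst Bochner_Integration.integral_sum[OF int]) (simp add: exp)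
  finally show ?thesis .
\<comment> \<open>For infinite \<open>J\<close> both the sum and \<open>card J\<close> are 0 by
  convention.\<close>
qed (use D trunc_mean_nonneg in simp)

section \<open>Localisation with high probability\<close>

lemma prob_not_localised_le:
  fixes R b :: nat and t C D \<epsilon> :: real
  defines "l \<equiv> ell \<mu> t"
  assumes t: "0 < t" and b: "0 < b" and l: "0 < l" and C: "1 \<le> C" and D: "0 < D"
    and \<epsilon>: "2 * R * D / t + 2 * (t / b + 2 * D) / (C * l) \<le> \<epsilon>"
  shows "measure (env \<mu>) {\<sigma> \<in> space (env \<mu>). \<bar>btm_prob \<sigma> t (Gamma \<mu> \<sigma> t) - 1\<bar> > \<epsilon>}
    \<le> 2 * (1 - tail l) ^ R + (2 * R + 1) * (tail l - tail (C * l))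
      + (2 * (R + b) + 1) * trunc_mean l / D + (2 * (R + b) + 1) * b * (tail l)\<^sup>2"
proof -
  interpret E: prob_space "env \<mu>" by (rule prob_space_env)
  interpret P: prob_space path_space by (rule prob_space_path_space)
  let ?N = "{- int (R + b)..int (R + b)}" and ?R = "{- int R..int R}"
  \<comment> \<open>Each event is the failure of one hypothesis of \<open>btm_prob_Gamma_ge\<close>,
    in the order \<open>right\<close>, \<open>left\<close>, \<open>gap\<close>,
    \<open>trunc\<close>, \<open>sep\<close>; a union bound adds their probabilities.\<close>
  define B1 where "B1 = {\<sigma>. \<forall>z\<in>{1..int R}. \<sigma> z \<in> {..l}}"
  define B2 where "B2 = {\<sigma>. \<forall>z\<in>{1 - int R..0}. \<sigma> z \<in> {..l}}"
  define B3 where "B3 = (\<Union>z\<in>?R. {\<sigma>. \<sigma> z \<in> {l<..C * l}})"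
  define B4 where "B4 = {\<sigma>. D < (\<Sum>z\<in>?N. \<sigma> z * indicator {0<..l} (\<sigma> z))}"
  define B5 where "B5 = (\<Union>z\<in>?N. \<Union>i\<in>{1..<b}. {\<sigma>. \<sigma> z \<in> {l<..} \<and> \<sigma> (z + int i) \<in> {l<..}})"
  have ev1: "{\<sigma>. \<sigma> z \<in> {l<..C * l}} \<in> sets (env \<mu>)" for z
    by (intro sets_env_Collect) measurable
  have ev2: "{\<sigma>. \<sigma> z \<in> {l<..} \<and> \<sigma> y \<in> {l<..}} \<in> sets (env \<mu>)" for z y
    by (intro sets_env_Collect) measurable
  have [measurable]: "B1 \<in> sets (env \<mu>)" "B2 \<in> sets (env \<mu>)" "B3 \<in> sets (env \<mu>)" "B4 \<in> sets (env \<mu>)" "B5 \<in> sets (env \<mu>)"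
    unfolding B1_def B2_def B3_def B4_def B5_def
    by (intro sets_env_Collect sets.finite_UN finite_atLeastAtMost_int finite_atLeastLessThan; measurable)+
  have low: "measure \<mu> {..l} = 1 - tail l" by (simp add: tail_eq_cdf cdf_def)
  have "measure (env \<mu>) B1 = (1 - tail l) ^ R" "measure (env \<mu>) B2 = (1 - tail l) ^ R"
    unfolding B1_def B2_def by (subst prob_env_all; simp add: low)+
  moreover have "measure (env \<mu>) B3 \<le> (2 * R + 1) * (tail l - tail (C * l))"
  proof -
    have "l \<le> C * l" using l C by simp
    then have "{l<..} - {C * l<..} = {l<..C * l}" by auto
    then have "measure \<mu> {l<..C * l} = tail l - tail (C * l)"
      unfolding tail_def using finite_measure_Diff[of "{l<..}" "{C * l<..}"] \<open>l \<le> C * l\<close> by simp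
    then have "measure (env \<mu>) B3 \<le> (\<Sum>z\<in>?R. tail l - tail (C * l))"
      unfolding B3_def by (intro order_trans[OF E.finite_measure_subadditive_finite] sum_mono)
        (use ev1 in \<open>auto simp: prob_env_single[of "{l<..C * l}", simplified]\<close>)
    then show ?thesis by (simp add: add.commute)
  qed
  moreover have "measure (env \<mu>) B4 \<le> (2 * (R + b) + 1) * trunc_mean l / D"
    unfolding B4_def by (rule order_trans[OF prob_trunc_sum_le[OF D]]) (simp add: algebra_simps)
  moreover have "measure (env \<mu>) B5 \<le> (2 * (R + b) + 1) * b * (tail l)\<^sup>2"
  proof -
    \<comment> \<open>Since \<open>i \<ge> 1\<close> the two sites are distinct and their depths
      independent.\<close>
    have "measure (env \<mu>) (\<Union>i\<in>{1..<b}. {\<sigma>. \<sigma> z \<in> {l<..} \<and> \<sigma> (z + int i) \<in> {l<..}})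
        \<le> (\<Sum>i\<in>{1..<b}. (tail l)\<^sup>2)" for z
      by (intro order_trans[OF E.finite_measure_subadditive_finite] sum_mono)
        (use ev2 in \<open>auto simp: prob_env_pair[of "{l<..}" "{l<..}", simplified] tail_def power2_eq_square\<close>)
    also have "(\<Sum>i\<in>{1..<b}. (tail l)\<^sup>2) \<le> b * (tail l)\<^sup>2"
      by (simp add: mult_right_mono)
    finally have inner: "measure (env \<mu>) (\<Union>i\<in>{1..<b}. {\<sigma>. \<sigma> z \<in> {l<..} \<and> \<sigma> (z + int i) \<in> {l<..}})
        \<le> b * (tail l)\<^sup>2" for z .
    have "measure (env \<mu>) B5 \<le> (\<Sum>z\<in>?N. measure (env \<mu>)
        (\<Union>i\<in>{1..<b}. {\<sigma>. \<sigma> z \<in> {l<..} \<and> \<sigma> (z + int i) \<in> {l<..}}))"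
      unfolding B5_def by (rule E.finite_measure_subadditive_finite) (use ev2 in auto)
    also have "\<dots> \<le> (\<Sum>z\<in>?N. b * (tail l)\<^sup>2)"
      by (intro sum_mono inner)
    finally have "measure (env \<mu>) B5 \<le> (\<Sum>z\<in>?N. b * (tail l)\<^sup>2)" .
    then show ?thesis by (simp add: algebra_simps)
  qed
  moreover have "measure (env \<mu>) {\<sigma> \<in> space (env \<mu>). \<bar>btm_prob \<sigma> t (Gamma \<mu> \<sigma> t) - 1\<bar> > \<epsilon>}
      \<le> measure (env \<mu>) (B1 \<union> B2 \<union> B3 \<union> B4 \<union> B5)"
  \<comment> \<open>Positivity of all depths is only almost sure, so the inclusion is shown almost
    everywhere.\<close>
  proof (rule E.finite_measure_mono_AE)
    show "AE \<sigma> in env \<mu>. \<sigma> \<in> {\<sigma> \<in> space (env \<mu>). \<bar>btm_prob \<sigma> t (Gamma \<mu> \<sigma> t) - 1\<bar> > \<epsilon>} \<longrightarrow> \<sigma> \<in> B1 \<union> B2 \<union> B3 \<union> B4 \<union> B5"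
      using AE_env_pos
    proof eventually_elim
      case (elim \<sigma>)
      have "\<not> \<bar>btm_prob \<sigma> t (Gamma \<mu> \<sigma> t) - 1\<bar> > \<epsilon>" if "\<sigma> \<notin> B1 \<union> B2 \<union> B3 \<union> B4 \<union> B5"
      proof -
        have "btm_prob \<sigma> t (Gamma \<mu> \<sigma> t) \<ge> 1 - (2 * R * D / t + 2 * (t / b + 2 * D) / (C * ell \<mu> t))"
        proof (rule btm_prob_Gamma_ge; (fold l_def)?)
          show "\<exists>z\<in>{1..int R}. l < \<sigma> z" "\<exists>z\<in>{1 - int R..0}. l < \<sigma> z"
            using that by (auto simp: B1_def B2_def not_le)
          show "C * l < \<sigma> z" if "z \<in> ?R" "l < \<sigma> z" for z
            using \<open>\<sigma> \<notin> _\<close> that by (force simp: B3_def)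
          show "(\<Sum>z\<in>?N. \<sigma> z * indicator {0<..l} (\<sigma> z)) \<le> D"
            using that by (auto simp: B4_def simp del: sum_mult_indicator)
          show "\<not> l < \<sigma> (z + int i)" if "z \<in> ?N" "i \<in> {1..<b}" "l < \<sigma> z" for z i
            using \<open>\<sigma> \<notin> _\<close> that by (force simp: B5_def)
        qed (use elim t b l C in auto)
        moreover have "btm_prob \<sigma> t (Gamma \<mu> \<sigma> t) \<le> 1" by (simp add: btm_prob_def)
        ultimately show ?thesis using \<epsilon> by (simp add: l_def)
      qed
      then show ?case by blast
    qed
  qed simp
  moreover have "measure (env \<mu>) (B1 \<union> B2 \<union> B3 \<union> B4 \<union> B5)
      \<le> measure (env \<mu>) B1 + measure (env \<mu>) B2 + measure (env \<mu>) B3 + measure (env \<mu>) B4 + measure (env \<mu>) B5"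
    by (intro order_trans[OF measure_Un_le] add_right_mono order_refl) auto
  ultimately show ?thesis by linarith
qed

text \<open>With \<open>r = L(ell)\<close>, take \<open>R\<close> of order \<open>r / e\<close> and
  \<open>b\<close> of order \<open>e\<^sup>2 * r\<close>: a window of \<open>R\<close> sites has no
  deep trap with probability at most \<open>e\<close>, and close pairs contribute order
  \<open>R * b / r\<^sup>2\<close>, that is, order \<open>e\<close>. The bound allowed for the
  truncated sum is \<open>\<delta> * l\<close>.\<close>

lemma localisation_bound:
  fixes t e \<epsilon> :: real
  defines "l \<equiv> ell \<mu> t" and "\<delta> \<equiv> e * \<epsilon> / 64" and "C \<equiv> 1 + 16 / (e\<^sup>2 * \<epsilon>)"
  assumes t: "0 < t" and l: "0 < l" and e: "0 < e" "e \<le> 1" and \<epsilon>: "0 < \<epsilon>"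
    and small: "tail l \<le> e\<^sup>2" and upper: "l * tailL \<mu> l \<le> 4 * t"
  shows "measure (env \<mu>) {\<sigma> \<in> space (env \<mu>). \<bar>btm_prob \<sigma> t (Gamma \<mu> \<sigma> t) - 1\<bar> > \<epsilon>}
    \<le> 20 * e + 5 / e * (1 - tail (l * C) / tail l) + 9 / (e * \<delta>) * (trunc_mean l / (l * tail l))"
proof -
  define r where "r = 1 / tail l"
  define R where "R = nat \<lceil>r / e\<rceil>"
  define b where "b = nat \<lceil>e\<^sup>2 * r\<rceil>"
  have tp: "0 < tail l" by (rule tail_pos)
  have r: "1 \<le> e\<^sup>2 * r" "tail l = 1 / r" "0 < r" using small tp by (auto simp: r_def)
  have e2: "e\<^sup>2 \<le> e" "e\<^sup>2 \<le> 1" "0 < e\<^sup>2"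
    using e by (auto simp: power2_eq_square mult_left_le mult_le_one)
  have r1: "1 \<le> r" using tp tail_le_1[of l] by (simp add: r_def)
  have re: "r \<le> r / e" "1 \<le> r / e" using r1 e by (auto simp: le_divide_eq mult_left_le intro: order_trans)
  \<comment> \<open>Both quantities are at least 1, the second by \<open>small\<close>, so rounding
    up at most doubles them.\<close>
  have R: "r / e \<le> R" "R \<le> 2 * r / e"
    unfolding R_def using re by linarith+
  have b: "e\<^sup>2 * r \<le> b" "b \<le> 2 * (e\<^sup>2 * r)" "0 < b"
    unfolding b_def using r(1) by linarith+
  have e2r: "e\<^sup>2 * r \<le> r / e"
    using e2(2) r(3) re(1) by (meson mult_left_le_one_le less_imp_le order_trans zero_le_power2)
  have Nb: "2 * (R + b) + 1 \<le> 9 * r / e"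
    using R b e2r re by simp
  have \<delta>: "0 < \<delta>" using e \<epsilon> by (simp add: \<delta>_def)
  have C: "1 \<le> C" using e \<epsilon> by (simp add: C_def)
  have t_le: "t \<le> l * r"
    using level_ge[of t] t by (simp add: l_def r_def tailL_eq)
  have lr: "l * r \<le> 4 * t" using upper by (simp add: r_def tailL_eq)
  \<comment> \<open>The error is at most
    \<open>\<epsilon> / 4 + \<epsilon> / 8 + \<epsilon> / 16\<close>: the first term is
    \<open>16 * \<delta> / e\<close>, the second comes from the choice of \<open>C\<close>, and the
    third is \<open>4 * \<delta>\<close> with \<open>e \<le> 1\<close>.\<close>
  have quenched: "2 * R * (\<delta> * l) / t + 2 * (t / b + 2 * (\<delta> * l)) / (C * l) \<le> \<epsilon>"
  proof -
    have "2 * R * (\<delta> * l) / t \<le> 2 * (2 * r / e) * (\<delta> * l) / t"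
      using R(2) \<delta> l t by (intro divide_right_mono mult_right_mono mult_left_mono) auto
    also have "\<dots> = 4 * \<delta> / e * (l * r) / t" by simp
    also have "\<dots> \<le> 4 * \<delta> / e * (4 * t) / t"
      using \<delta> e t lr by (intro divide_right_mono mult_left_mono) auto
    also have "\<dots> = \<epsilon> / 4" using e t by (simp add: \<delta>_def)
    finally have 1: "2 * R * (\<delta> * l) / t \<le> \<epsilon> / 4" .
    have "t / b \<le> (l * r) / (e\<^sup>2 * r)"
      using t_le b t r e2 l by (intro frac_le) auto
    also have "\<dots> = l / e\<^sup>2" using r by simp
    finally have "2 * (t / b + 2 * (\<delta> * l)) / (C * l) \<le> 2 * (l / e\<^sup>2 + 2 * (\<delta> * l)) / (C * l)"
      using C l by (intro divide_right_mono) auto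
    also have "\<dots> = (2 / e\<^sup>2) / C + 4 * \<delta> / C"
      using C l by (simp add: field_simps)
    also have "\<dots> \<le> \<epsilon> / 8 + 4 * \<delta>"
    proof (rule add_mono)
      have "16 / (e\<^sup>2 * \<epsilon>) \<le> C" by (simp add: C_def)
      then show "(2 / e\<^sup>2) / C \<le> \<epsilon> / 8" using e2 \<epsilon> C by (simp add: field_simps)
      show "4 * \<delta> / C \<le> 4 * \<delta>" using C \<delta> by (simp add: divide_le_eq)
    qed
    also have "4 * \<delta> \<le> \<epsilon> / 16" using e \<epsilon> by (simp add: \<delta>_def)
    finally show ?thesis using 1 \<epsilon> by linarith
  qed
  have empty: "(1 - tail l) ^ R \<le> e"
    using tail_le_1[of l] tp e R(1) by (intro power_one_minus_le) (auto simp: r_def field_simps)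
  have "(2 * R + 1) * (tail l - tail (C * l)) \<le> 5 * r / e * (tail l - tail (C * l))"
    using R re tail_antimono[of l "C * l"] C l by (intro mult_right_mono) auto
  also have "\<dots> = 5 / e * (1 - tail (l * C) / tail l)"
    using tp by (simp add: r_def field_simps)
  finally have gap: "(2 * R + 1) * (tail l - tail (C * l)) \<le> 5 / e * (1 - tail (l * C) / tail l)" .
  have "(2 * (R + b) + 1) * trunc_mean l / (\<delta> * l) \<le> 9 * r / e * trunc_mean l / (\<delta> * l)"
    using Nb \<delta> l trunc_mean_nonneg[of l] by (intro divide_right_mono mult_right_mono) auto
  also have "\<dots> = 9 / (e * \<delta>) * (trunc_mean l / (l * tail l))"
    by (simp add: r_def)
  finally have trunc: "(2 * (R + b) + 1) * trunc_mean l / (\<delta> * l) \<le> 9 / (e * \<delta>) * (trunc_mean l / (l * tail l))" .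
  have "(2 * (R + b) + 1) * b * (tail l)\<^sup>2 \<le> (9 * r / e) * (2 * (e\<^sup>2 * r)) * (tail l)\<^sup>2"
    unfolding of_nat_mult using Nb b r e by (intro mult_right_mono mult_mono) auto
  also have "\<dots> = 18 * e"
    using e r by (simp add: power2_eq_square)
  finally have close: "(2 * (R + b) + 1) * b * (tail l)\<^sup>2 \<le> 18 * e" .
  have "measure (env \<mu>) {\<sigma> \<in> space (env \<mu>). \<bar>btm_prob \<sigma> t (Gamma \<mu> \<sigma> t) - 1\<bar> > \<epsilon>}
      \<le> 2 * (1 - tail l) ^ R + (2 * R + 1) * (tail l - tail (C * l))
      + (2 * (R + b) + 1) * trunc_mean l / (\<delta> * l) + (2 * (R + b) + 1) * b * (tail l)\<^sup>2"
    unfolding l_def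
    by (rule prob_not_localised_le) (use t b(3) l C \<delta> quenched in \<open>simp_all add: l_def\<close>)
  also have "\<dots> \<le> 2 * e + 5 / e * (1 - tail (l * C) / tail l) + 9 / (e * \<delta>) * (trunc_mean l / (l * tail l)) + 18 * e"
    by (intro add_mono mult_left_mono empty gap trunc close) simp
  finally show ?thesis by simp
qed

text \<open>First \<open>e\<close> is fixed so that the terms of order \<open>e\<close> cost at most
  \<open>\<kappa> / 2\<close>; with \<open>e\<close> fixed, slow variation and
  \<open>trunc_mean_small\<close> along \<open>u = ell \<mu> t\<close> bring the rest below
  \<open>\<kappa> / 2\<close>.\<close>

lemma localisation:
  assumes \<epsilon>: "0 < \<epsilon>"
  shows "((\<lambda>t. measure (env \<mu>) {\<sigma> \<in> space (env \<mu>). \<bar>btm_prob \<sigma> t (Gamma \<mu> \<sigma> t) - 1\<bar> > \<epsilon>}) \<longlongrightarrow> 0) at_top"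
proof (rule tendstoI)
  fix \<kappa> :: real assume \<kappa>: "0 < \<kappa>"
  define e where "e = min 1 (\<kappa> / 40)"
  have e: "0 < e" "e \<le> 1" "20 * e \<le> \<kappa> / 2" using \<kappa> by (auto simp: e_def)
  define \<delta> where "\<delta> = e * \<epsilon> / 64"
  define C where "C = 1 + 16 / (e\<^sup>2 * \<epsilon>)"
  have C: "0 < C" using e \<epsilon> by (simp add: C_def add_pos_nonneg)
  \<comment> \<open>\<open>inverse\<close> puts the ratio in the direction in which
    \<open>tail_ratio\<close> gives its limit.\<close>
  have "((\<lambda>u. 5 / e * (1 - inverse (tail u / tail (u * C))) + 9 / (e * \<delta>) * (trunc_mean u / (u * tail u)))
      \<longlongrightarrow> 5 / e * (1 - inverse 1) + 9 / (e * \<delta>) * 0) at_top"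
    by (intro tendsto_intros tail_ratio trunc_mean_small C) auto
  then have "\<forall>\<^sub>F u in at_top. 5 / e * (1 - inverse (tail u / tail (u * C))) + 9 / (e * \<delta>) * (trunc_mean u / (u * tail u)) < \<kappa> / 2"
    by (rule order_tendstoD) (use \<kappa> in simp)
  moreover have "\<forall>\<^sub>F u in at_top. tail u < e\<^sup>2"
    using tail_tendsto_0 by (rule order_tendstoD) (use e in simp)
  moreover have "\<forall>\<^sub>F u::real in at_top. 0 < u" by (rule eventually_gt_at_top)
  ultimately have "\<forall>\<^sub>F u in at_top. 0 < u \<and> tail u < e\<^sup>2 \<and>
      5 / e * (1 - tail (u * C) / tail u) + 9 / (e * \<delta>) * (trunc_mean u / (u * tail u)) < \<kappa> / 2"
    by eventually_elim simp
  then have "\<forall>\<^sub>F t in at_top. 0 < ell \<mu> t \<and> tail (ell \<mu> t) < e\<^sup>2 \<and>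
      5 / e * (1 - tail (ell \<mu> t * C) / tail (ell \<mu> t))
      + 9 / (e * \<delta>) * (trunc_mean (ell \<mu> t) / (ell \<mu> t * tail (ell \<mu> t))) < \<kappa> / 2"
    using ell_at_top by (rule eventually_compose_filterlim)
  with ell_upper eventually_gt_at_top[of 0]
  show "\<forall>\<^sub>F t in at_top. dist (measure (env \<mu>) {\<sigma> \<in> space (env \<mu>). \<bar>btm_prob \<sigma> t (Gamma \<mu> \<sigma> t) - 1\<bar> > \<epsilon>}) 0 < \<kappa>"
  proof eventually_elim
    case (elim t)
    have "measure (env \<mu>) {\<sigma> \<in> space (env \<mu>). \<bar>btm_prob \<sigma> t (Gamma \<mu> \<sigma> t) - 1\<bar> > \<epsilon>} < \<kappa>"
      using localisation_bound[of t e \<epsilon>, folded \<delta>_def C_def] elim e \<epsilon> by linarith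
    then show ?case by simp
  qed
qed

end

theorem theorem1p1:
  fixes \<mu> :: "real measure"
  assumes "prob_space \<mu>"
    and "sets \<mu> = sets borel"
    and "AE x in \<mu>. 0 < x"
    and "slowly_varying (tailL \<mu>)"
  shows "\<forall>\<epsilon>>0. ((\<lambda>t. measure (env \<mu>)
            {\<sigma> \<in> space (env \<mu>). \<bar>btm_prob \<sigma> t (Gamma \<mu> \<sigma> t) - 1\<bar> > \<epsilon>})
          \<longlongrightarrow> 0) at_top"
proof -
  interpret slow_tail \<mu>
    using assms by (simp add: slow_tail_def slow_tail_axioms_def)
  show ?thesis using localisation by blast
qed

end
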